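(* Let $K$ be a field and $K(X)$ the field of rational functions over $K$. Let $K(X)$ be equipped with a non-Archimedean valuation $|\cdot|$ whose restriction to the subfield $K\subseteq K(X)$ is trivial. Let $f,g,h\in K(X)$ satisfy $|f|>1$, $|g|>1$, $|h|=|fg|=|fg-h|$. Then for any $W\in\mathrm{Conj}(F_2)$ with $W\ne[1_{F_2}]$, the rational function $\Psi(W):=\Phi(W)(f,g,h)\in K(X)$ satisfies $$|\Psi(W)|=|f|^{l_a(W)}\cdot|g|^{l_b(W)}>1 .$$ In particular, $\Psi(W)\notin K$ for $W\ne[1_{F_2}]$.
   Context: A non-Archimedean valuation on a field $L$ is $|\cdot|:L\to[0,\infty)$ with $|x|=0\iff x=0$, $|xy|=|x||y|$, $|x+y|\le\max\{|x|,|y|\}$; it is trivial on a subfield if all nonzero elements of that subfield have value $1$. $F_2$ is the free group on $\{a,b\}$ and $\mathrm{Conj}(F_2)$ its set of conjugacy classes; $[w]$ denotes the class of $w$. $\mathbb P$ is the prime ring of $K$ (the smallest subring containing $1$: $\mathbb Z$ or $\mathbb F_p$). Canonical representatives and lengths. Every class $W$ contains an element of the form $1$, $a^{n_1}$, $b^{m_1}$, or $w=a^{n_1}b^{m_1}\cdots a^{n_k}b^{m_k}$ with $k\ge1$, all $n_i,m_i\in\mathbb Z\setminus\{0\}$. In the last case such a $w$ is determined up to cyclic permutation of the syllables $s_i=a^{n_i}b^{m_i}$; the canonical representative is the one for which $(\max\{|n_1|,|m_1|\},\dots,\max\{|n_k|,|m_k|\})$ is lexicographically maximal and, among these, $(n_1,m_1,\dots,n_k,m_k)$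 is lexicographically maximal. Put $l_a(W)=\sum|n_i|$, $l_b(W)=\sum|m_i|$ (with $l_a=l_b=0$ for $[1]$; $l_a([a^{n}])=|n|$, $l_b([a^n])=0$; $l_a([b^m])=0$, $l_b([b^m])=|m|$) and $l(W)=l_a(W)+l_b(W)$. The map $\Phi:\mathrm{Conj}(F_2)\to\mathbb P[x,y,z]$ (polynomials in three variables) is defined by recursion on $l(W)$. On the special classes: $\Phi([1])=2$; $\Phi([a])=\Phi([a^{-1}])=x$; $\Phi([b])=\Phi([b^{-1}])=y$; $\Phi([ab])=\Phi([a^{-1}b^{-1}])=z$; $\Phi([a^{-1}b])=\Phi([ab^{-1}])=xy-z$; $\Phi([aba^{-1}b^{-1}])=\Phi([ab^{-1}a^{-1}b])=x^2+y^2+z^2-xyz-2$; $\Phi([aba^{-1}b])=\Phi([ab^{-1}a^{-1}b^{-1}])=-x^2-z^2+xyz+2$. For other $W$, with $l(W)\ge2$ and canonical representative $w$: (i) If $|n_1|\ge2$, write $w=a^{n_1}u$ with $u=b^{m_1}\cdots a^{n_k}b^{m_k}$ or $u=1$, and set $\Phi(W)=x\,\Phi([a^{n_1-\mathrm{sgn}(n_1)}u])-\Phi([a^{n_1-2\,\mathrm{sgn}(n_1)}u])$. (ii) If $|m_1|\ge2$ and either $|n_1|=1$ or $w=b^{m_1}$, write $W=[b^{m_1}u]$ with $u=a^{n_2}b^{m_2}\cdots a^{n_k}b^{m_k}a^{n_1}$ or $u=1$ respectively, and set $\Phi(W)=y\,\Phi([b^{m_1-\mathrm{sgn}(m_1)}u])-\Phi([b^{m_1-2\,\mathrm{sgn}(m_1)}u])$.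 (iii) Otherwise all $|n_i|=|m_i|=1$ and $W$ is not special; take the lexicographically smallest pair $(i,j)$ with $1\le i<j\le k$ and $n_i=n_j$ (it exists), let $u=s_i\cdots s_{j-1}$, $v=s_j\cdots s_ks_1\cdots s_{i-1}$ (so $W=[uv]$), and set $\Phi(W)=\Phi([u])\,\Phi([v])-\Phi([u^{-1}v])$. $\Phi(W)(f,g,h)$ denotes substitution $x=f,y=g,z=h$. *)

theory Defs
  imports
    "HOL-Algebra.Group"
    "HOL-Computational_Algebra.Computational_Algebra"
    "HOL-Library.List_Lexorder"
begin

section \<open>The free group of rank two\<close>

type_synonym 'g word = "('g \<times> bool) list"

text \<open>The letter \<open>(g, True)\<close> stands for the generator \<open>g\<close>, and \<open>(g, False)\<close> for its inverse.\<close>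

definition flip :: "'g \<times> bool \<Rightarrow> 'g \<times> bool" where
  "flip x = (fst x, \<not> snd x)"

definition reduced :: "'g word \<Rightarrow> bool" where
  "reduced w \<longleftrightarrow> successively (\<lambda>x y. y \<noteq> flip x) w"

fun push :: "'g \<times> bool \<Rightarrow> 'g word \<Rightarrow> 'g word" where
  "push x [] = [x]"
| "push x (y # w) = (if y = flip x then w else x # y # w)"

definition reduce :: "'g word \<Rightarrow> 'g word" where
  "reduce w = foldr push w []"

definition free_group :: "'g word monoid" where
  "free_group = \<lparr>carrier = {w. reduced w}, monoid.mult = (\<lambda>u v. reduce (u @ v)), one = []\<rparr>"

lemma flip_flip [simp]: "flip (flip x) = x"
  by (simp add: flip_def)

lemma flip_neq [simp]: "flip x \<noteq> x" "x \<noteq> flip x"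
  by (auto simp: flip_def prod_eq_iff)

lemma reduced_Nil [simp]: "reduced []"
  by (simp add: reduced_def)

lemma reduced_Cons: "reduced (x # w) \<longleftrightarrow> reduced w \<and> (w = [] \<or> hd w \<noteq> flip x)"
  by (cases w) (auto simp: reduced_def)

lemma reduced_append:
  "reduced (u @ v) \<longleftrightarrow> reduced u \<and> reduced v \<and> (u = [] \<or> v = [] \<or> hd v \<noteq> flip (last u))"
  by (auto simp: reduced_def successively_append_iff)

lemma reduced_push: "reduced w \<Longrightarrow> reduced (push x w)"
  by (cases w) (auto simp: reduced_Cons)

lemma reduced_foldr_push: "reduced v \<Longrightarrow> reduced (foldr push u v)"
  by (induction u) (auto intro: reduced_push)

lemma reduced_reduce: "reduced (reduce w)"
  by (simp add: reduce_def reduced_foldr_push)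

lemma push_Cons_reduced: "reduced (x # w) \<Longrightarrow> push x w = x # w"
  by (cases w) (auto simp: reduced_Cons)

lemma reduce_reduced: "reduced w \<Longrightarrow> reduce w = w"
  by (induction w) (auto simp: reduce_def push_Cons_reduced reduced_Cons)

lemma foldr_push_nil: "reduced v \<Longrightarrow> reduce (u @ v) = foldr push u v"
  by (metis foldr_append reduce_def reduce_reduced)

lemma push_flip: "reduced w \<Longrightarrow> push (flip x) (push x w) = w"
  by (cases w) (auto simp: push_Cons_reduced)

lemma push_flip': "reduced w \<Longrightarrow> push x (push (flip x) w) = w"
  using push_flip[of w "flip x"] by simp

lemma foldr_push_push:
  assumes "reduced w"
  shows "foldr push (push x v) w = push x (foldr push v w)"
  using assms by (cases v) (auto simp: push_flip' reduced_foldr_push)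

lemma foldr_push_assoc:
  "reduced w \<Longrightarrow> foldr push (foldr push u v) w = foldr push u (foldr push v w)"
  by (induction u) (auto simp: foldr_push_push)

lemma foldr_push_inverse:
  "reduced v \<Longrightarrow> foldr push (rev (map flip w)) (foldr push w v) = v"
  by (induction w arbitrary: v) (auto simp: push_flip reduced_foldr_push)

lemma reduced_rev_flip: "reduced w \<Longrightarrow> reduced (rev (map flip w))"
  unfolding reduced_def
  by (auto simp: successively_map elim!: successively_mono)

lemma carrier_free_group: "carrier free_group = {w. reduced w}"
  and one_free_group: "\<one>\<^bsub>free_group\<^esub> = []"
  by (simp_all add: free_group_def)

lemma mult_free_group: "reduced v \<Longrightarrow> u \<otimes>\<^bsub>free_group\<^esub> v = foldr push u v"
  by (simp add: free_group_def foldr_push_nil)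

lemma group_free_group: "group free_group"
proof (rule groupI)
  fix x :: "'a word"
  assume "x \<in> carrier free_group"
  then have x: "reduced x" by (simp add: carrier_free_group)
  have "rev (map flip x) \<otimes>\<^bsub>free_group\<^esub> x = \<one>\<^bsub>free_group\<^esub>"
    using x foldr_push_inverse[of "[]" x] reduce_reduced[of x]
    by (simp add: mult_free_group one_free_group reduce_def)
  then show "\<exists>y\<in>carrier free_group. y \<otimes>\<^bsub>free_group\<^esub> x = \<one>\<^bsub>free_group\<^esub>"
    using reduced_rev_flip[OF x] by (auto simp: carrier_free_group)
qed (auto simp: carrier_free_group one_free_group mult_free_group reduced_foldr_push
       foldr_push_assoc)

interpretation free_group: group free_group
  by (rule group_free_group)

lemma inv_free_group: "reduced w \<Longrightarrow> inv\<^bsub>free_group\<^esub> w = rev (map flip w)"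
  using foldr_push_inverse[of "[]" w] reduce_reduced[of w]
  by (intro free_group.inv_equality)
     (auto simp: carrier_free_group mult_free_group one_free_group reduce_def reduced_rev_flip)

datatype gen = Gen_a | Gen_b

abbreviation F2 :: "gen word monoid" where
  "F2 \<equiv> free_group"

definition gen_a :: "gen word" where "gen_a = [(Gen_a, True)]"
definition gen_b :: "gen word" where "gen_b = [(Gen_b, True)]"

definition conj_class :: "('g, 'm) monoid_scheme \<Rightarrow> 'g \<Rightarrow> 'g set" where
  "conj_class G g = {h \<otimes>\<^bsub>G\<^esub> g \<otimes>\<^bsub>G\<^esub> inv\<^bsub>G\<^esub> h | h. h \<in> carrier G}"

definition Conj :: "('g, 'm) monoid_scheme \<Rightarrow> 'g set set" where
  "Conj G = conj_class G ` carrier G"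


section \<open>Canonical representatives and lengths\<close>

text \<open>The list \<open>[(n\<^sub>1, m\<^sub>1), \<dots>, (n\<^sub>k, m\<^sub>k)]\<close> encodes
  $a^{n_1} b^{m_1} \cdots a^{n_k} b^{m_k}$.\<close>

fun syl :: "(int \<times> int) list \<Rightarrow> gen word" where
  "syl [] = \<one>\<^bsub>F2\<^esub>"
| "syl ((n, m) # xs) = (gen_a [^]\<^bsub>F2\<^esub> n \<otimes>\<^bsub>F2\<^esub> gen_b [^]\<^bsub>F2\<^esub> m) \<otimes>\<^bsub>F2\<^esub> syl xs"

definition cls :: "(int \<times> int) list \<Rightarrow> gen word set" where
  "cls xs = conj_class F2 (syl xs)"

text \<open>The four shapes are $1$, $a^{n}$, $b^{m}$, and
  $a^{n_1} b^{m_1} \cdots a^{n_k} b^{m_k}$ with nonzero exponents.\<close>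

definition normal_form :: "(int \<times> int) list \<Rightarrow> bool" where
  "normal_form xs \<longleftrightarrow>
     xs = [] \<or> (\<exists>n. n \<noteq> 0 \<and> xs = [(n, 0)]) \<or> (\<exists>m. m \<noteq> 0 \<and> xs = [(0, m)]) \<or>
     (xs \<noteq> [] \<and> (\<forall>(n, m) \<in> set xs. n \<noteq> 0 \<and> m \<noteq> 0))"

definition normal_forms :: "gen word set \<Rightarrow> (int \<times> int) list set" where
  "normal_forms W = {xs. normal_form xs \<and> syl xs \<in> W}"

definition max_seq :: "(int \<times> int) list \<Rightarrow> int list" where
  "max_seq xs = map (\<lambda>(n, m). max \<bar>n\<bar> \<bar>m\<bar>) xs"

definition exp_seq :: "(int \<times> int) list \<Rightarrow> int list" where
  "exp_seq xs = concat (map (\<lambda>(n, m). [n, m]) xs)"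

text \<open>The order on lists is the lexicographic one.\<close>

definition is_canonical :: "gen word set \<Rightarrow> (int \<times> int) list \<Rightarrow> bool" where
  "is_canonical W xs \<longleftrightarrow> xs \<in> normal_forms W \<and>
     (\<forall>ys \<in> normal_forms W. max_seq ys \<le> max_seq xs) \<and>
     (\<forall>ys \<in> normal_forms W. max_seq ys = max_seq xs \<longrightarrow> exp_seq ys \<le> exp_seq xs)"

definition canonical :: "gen word set \<Rightarrow> (int \<times> int) list" where
  "canonical W = (THE xs. is_canonical W xs)"

definition l_a :: "gen word set \<Rightarrow> nat" where
  "l_a W = (\<Sum>(n, m) \<leftarrow> canonical W. nat \<bar>n\<bar>)"

definition l_b :: "gen word set \<Rightarrow> nat" where
  "l_b W = (\<Sum>(n, m) \<leftarrow> canonical W. nat \<bar>m\<bar>)"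


subsection \<open>Existence and uniqueness of the canonical representative\<close>

context group
begin

lemma conj_classI:
  "h \<in> carrier G \<Longrightarrow> h \<otimes> g \<otimes> inv h \<in> conj_class G g"
  by (auto simp: conj_class_def)

lemma conj_class_self: "g \<in> carrier G \<Longrightarrow> g \<in> conj_class G g"
  using conj_classI[of \<one> g] by simp

lemma conj_class_subset:
  assumes "g \<in> carrier G" "g' \<in> conj_class G g"
  shows "conj_class G g' \<subseteq> conj_class G g"
proof -
  obtain h where h: "h \<in> carrier G" "g' = h \<otimes> g \<otimes> inv h"
    using assms(2) by (auto simp: conj_class_def)
  have "k \<otimes> g' \<otimes> inv k \<in> conj_class G g" if "k \<in> carrier G" for k
  proof -
    have "k \<otimes> g' \<otimes> inv k = (k \<otimes> h) \<otimes> g \<otimes> inv (k \<otimes> h)"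
      using h that assms(1) by (simp add: inv_mult_group m_assoc)
    then show ?thesis using conj_classI[of "k \<otimes> h" g] h that by simp
  qed
  then show ?thesis by (auto simp: conj_class_def[of G g'])
qed

lemma conj_class_sym:
  assumes "g \<in> carrier G" "g' \<in> conj_class G g"
  shows "g \<in> conj_class G g'"
proof -
  obtain h where h: "h \<in> carrier G" "g' = h \<otimes> g \<otimes> inv h"
    using assms(2) by (auto simp: conj_class_def)
  have "inv h \<otimes> (h \<otimes> g \<otimes> inv h) \<otimes> inv (inv h) = g"
    using h assms(1) by (metis inv_closed inv_solve_left inv_solve_right m_assoc m_closed inv_inv)
  then show ?thesis using conj_classI[of "inv h" g'] h by simp
qed

lemma conj_class_carrier: "g \<in> carrier G \<Longrightarrow> conj_class G g \<subseteq> carrier G"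
  by (auto simp: conj_class_def)

lemma conj_class_eq:
  assumes "g \<in> carrier G" "g' \<in> conj_class G g"
  shows "conj_class G g' = conj_class G g"
  using conj_class_subset[OF assms] conj_class_sym[OF assms] conj_class_subset[of g' g]
    conj_class_carrier[of g] assms by blast

lemma conj_class_mult_commute:
  assumes "g \<in> carrier G" "h \<in> carrier G"
  shows "conj_class G (g \<otimes> h) = conj_class G (h \<otimes> g)"
proof -
  have "h \<otimes> (g \<otimes> h) \<otimes> inv h = h \<otimes> g"
    using assms by (simp add: m_assoc)
  then show ?thesis
    using conj_class_eq[of "g \<otimes> h"] conj_classI[of h "g \<otimes> h"] assms by simp
qed

lemma Conj_conj_class: "W \<in> Conj G \<Longrightarrow> w \<in> W \<Longrightarrow> W = conj_class G w"
  by (auto simp: Conj_def dest: conj_class_eq)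

lemma Conj_carrier: "W \<in> Conj G \<Longrightarrow> w \<in> W \<Longrightarrow> w \<in> carrier G"
  using conj_class_carrier by (auto simp: Conj_def)

lemma conj_pow:
  assumes "h \<in> carrier G" "w \<in> carrier G"
  shows "(h \<otimes> w \<otimes> inv h) [^] (k::nat) = h \<otimes> w [^] k \<otimes> inv h"
proof (induction k)
  case (Suc k)
  have "h \<otimes> w [^] k \<otimes> inv h \<otimes> (h \<otimes> w \<otimes> inv h) = h \<otimes> w [^] k \<otimes> (inv h \<otimes> h) \<otimes> w \<otimes> inv h"
    using assms by (simp only: m_assoc nat_pow_closed m_closed inv_closed)
  also have "\<dots> = h \<otimes> w [^] Suc k \<otimes> inv h"
    using assms by (simp add: m_assoc)
  finally show ?case using Suc by simp
qed (use assms in simp)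

end

lemma gen_closed [simp]: "gen_a \<in> carrier F2" "gen_b \<in> carrier F2"
  by (simp_all add: gen_a_def gen_b_def carrier_free_group reduced_def)

lemma syl_closed [simp]: "syl xs \<in> carrier F2"
  by (induction xs rule: syl.induct) auto

lemma syl_append: "syl (xs @ ys) = syl xs \<otimes>\<^bsub>F2\<^esub> syl ys"
  by (induction xs rule: syl.induct) (auto simp: free_group.m_assoc)

lemma cls_rotate: "cls (xs @ ys) = cls (ys @ xs)"
  by (simp add: cls_def syl_append free_group.conj_class_mult_commute)

lemma cls_Conj [simp]: "cls xs \<in> Conj F2"
  by (simp add: cls_def Conj_def)

definition pw :: "'g \<Rightarrow> int \<Rightarrow> 'g word" where
  "pw g n = replicate (nat \<bar>n\<bar>) (g, 0 \<le> n)"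

lemma reduced_replicate: "reduced (replicate k x)"
  by (induction k) (auto simp: reduced_Cons)

lemma mult_eq_append: "reduced (u @ v) \<Longrightarrow> u \<otimes>\<^bsub>free_group\<^esub> v = u @ v"
  by (simp add: free_group_def reduce_reduced)

lemma gen_nat_pow: "[(g, True)] [^]\<^bsub>free_group\<^esub> (k::nat) = replicate k (g, True)"
proof (induction k)
  case (Suc k)
  have "replicate k (g, True) @ [(g, True)] = replicate (Suc k) (g, True)"
    by (simp add: replicate_append_same)
  then show ?case
    using Suc mult_eq_append[of "replicate k (g, True)" "[(g, True)]"]
      reduced_replicate[of "Suc k" "(g, True)"] by simp
qed (simp add: one_free_group)

lemma gen_int_pow: "[(g, True)] [^]\<^bsub>free_group\<^esub> (n::int) = pw g n"
  by (auto simp: int_pow_def2 gen_nat_pow inv_free_group reduced_replicate pw_def flip_def)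

lemma pow_gen_a: "gen_a [^]\<^bsub>F2\<^esub> (n::int) = pw Gen_a n"
  and pow_gen_b: "gen_b [^]\<^bsub>F2\<^esub> (n::int) = pw Gen_b n"
  by (simp_all add: gen_a_def gen_b_def gen_int_pow)

lemma length_push: "length (push x w) \<le> Suc (length w)"
  by (cases w) auto

lemma length_foldr_push: "length (foldr push u v) \<le> length u + length v"
proof (induction u)
  case (Cons x u)
  then show ?case using length_push[of x "foldr push u v"] by simp
qed simp

lemma length_mult: "length (u \<otimes>\<^bsub>free_group\<^esub> v) \<le> length u + length v"
  using length_foldr_push[of "u @ v" "[]"] by (simp add: free_group_def reduce_def)

lemma length_inv: "w \<in> carrier free_group \<Longrightarrow> length (inv\<^bsub>free_group\<^esub> w) = length w"
  by (simp add: carrier_free_group inv_free_group)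

lemma length_pow: "length (w [^]\<^bsub>free_group\<^esub> (k::nat)) \<le> k * length w"
proof (induction k)
  case (Suc k)
  then show ?case using length_mult[of "w [^]\<^bsub>free_group\<^esub> k" w] by simp
qed (simp add: one_free_group)

lemma length_pw [simp]: "length (pw g n) = nat \<bar>n\<bar>"
  by (simp add: pw_def)

definition wlen :: "(int \<times> int) list \<Rightarrow> nat" where
  "wlen xs = (\<Sum>(n, m) \<leftarrow> xs. nat \<bar>n\<bar> + nat \<bar>m\<bar>)"

lemma wlen_simps [simp]:
  "wlen [] = 0" "wlen ((n, m) # xs) = nat \<bar>n\<bar> + nat \<bar>m\<bar> + wlen xs"
  "wlen (xs @ ys) = wlen xs + wlen ys"
  by (simp_all add: wlen_def)

lemma length_syl_le: "length (syl xs) \<le> wlen xs"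
proof (induction xs rule: syl.induct)
  case (2 n m xs)
  have "length (syl ((n, m) # xs)) \<le> length (pw Gen_a n) + length (pw Gen_b m) + length (syl xs)"
    unfolding syl.simps pow_gen_a pow_gen_b by (meson add_right_mono le_trans length_mult)
  then show ?case using 2 by simp
qed (simp add: one_free_group)

definition all_nz :: "(int \<times> int) list \<Rightarrow> bool" where
  "all_nz xs \<longleftrightarrow> (\<forall>(n, m) \<in> set xs. n \<noteq> 0 \<and> m \<noteq> 0)"

lemma syl_all_nz:
  assumes "all_nz xs"
  shows "length (syl xs) = wlen xs \<and> (syl xs = [] \<or> fst (hd (syl xs)) = Gen_a)"
  using assms
proof (induction xs rule: syl.induct)
  case (2 n m xs)
  have nz: "n \<noteq> 0" "m \<noteq> 0" "all_nz xs" using 2 by (auto simp: all_nz_def)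
  note IH = 2(1)[OF nz(3)]
  have ne: "pw Gen_a n \<noteq> []" "pw Gen_b m \<noteq> []" using nz by (auto simp: pw_def)
  have hd: "fst (hd (pw Gen_a n)) = Gen_a" "fst (hd (pw Gen_b m)) = Gen_b"
      "fst (last (pw Gen_a n)) = Gen_a" "fst (last (pw Gen_b m)) = Gen_b"
    using nz by (auto simp: pw_def)
  have ab: "reduced (pw Gen_a n @ pw Gen_b m)"
    using hd by (auto simp: reduced_append pw_def reduced_replicate flip_def)
  have "reduced (syl xs)" using syl_closed[of xs] by (simp add: carrier_free_group)
  then have r: "reduced ((pw Gen_a n @ pw Gen_b m) @ syl xs)"
    using ab hd ne IH unfolding reduced_append[of "pw Gen_a n @ pw Gen_b m"] by (auto simp: flip_def)
  have "syl ((n, m) # xs) = (pw Gen_a n @ pw Gen_b m) @ syl xs"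
    using mult_eq_append[OF r] mult_eq_append[OF ab] by (simp add: pow_gen_a pow_gen_b)
  then show ?case using IH hd ne by (auto simp: hd_append)
qed (simp add: one_free_group)

lemma syl_pow: "syl (concat (replicate k xs)) = syl xs [^]\<^bsub>F2\<^esub> (k::nat)"
proof (induction k)
  case (Suc k)
  have "syl xs \<otimes>\<^bsub>F2\<^esub> syl xs [^]\<^bsub>F2\<^esub> k = syl xs [^]\<^bsub>F2\<^esub> k \<otimes>\<^bsub>F2\<^esub> syl xs"
    by (metis free_group.nat_pow_Suc2 nat_pow_Suc syl_closed)
  then show ?case using Suc by (simp add: syl_append)
qed simp

lemma length_pow_normal_form:
  assumes "normal_form xs"
  shows "length (syl xs [^]\<^bsub>F2\<^esub> (k::nat)) = k * wlen xs"
proof -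
  consider "all_nz xs" | n where "xs = [(n, 0)]" | m where "xs = [(0, m)]"
    using assms by (auto simp: normal_form_def all_nz_def)
  then show ?thesis
  proof cases
    case 1
    then have "all_nz (concat (replicate k xs))" by (auto simp: all_nz_def)
    then have "length (syl (concat (replicate k xs))) = wlen (concat (replicate k xs))"
      using syl_all_nz by blast
    also have "\<dots> = k * wlen xs" by (induction k) auto
    finally show ?thesis by (simp add: syl_pow)
  next
    case (2 n)
    have "syl xs [^]\<^bsub>F2\<^esub> k = (gen_a [^]\<^bsub>F2\<^esub> n) [^]\<^bsub>F2\<^esub> int k"
      by (simp add: 2 int_pow_int)
    also have "\<dots> = pw Gen_a (n * int k)"
      by (subst free_group.int_pow_pow) (simp_all only: gen_closed pow_gen_a)
    finally show ?thesis by (simp add: 2 abs_mult nat_mult_distrib)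
  next
    case (3 m)
    have "syl xs [^]\<^bsub>F2\<^esub> k = (gen_b [^]\<^bsub>F2\<^esub> m) [^]\<^bsub>F2\<^esub> int k"
      by (simp add: 3 int_pow_int)
    also have "\<dots> = pw Gen_b (m * int k)"
      by (subst free_group.int_pow_pow) (simp_all only: gen_closed pow_gen_b)
    finally show ?thesis by (simp add: 3 abs_mult nat_mult_distrib)
  qed
qed

text \<open>A normal form is cyclically reduced, hence of minimal length in its conjugacy class.\<close>

lemma normal_form_minimal:
  assumes "normal_form xs" "w \<in> cls xs"
  shows "wlen xs \<le> length w"
proof (rule ccontr)
  assume "\<not> wlen xs \<le> length w"
  then have less: "Suc (length w) \<le> wlen xs" by simp
  have w: "w \<in> carrier F2" using assms(2) free_group.Conj_carrier[of "cls xs" w] by simp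
  have "syl xs \<in> conj_class F2 w"
    using assms(2) free_group.conj_class_sym[of "syl xs" w] by (simp add: cls_def)
  then obtain h where h: "h \<in> carrier F2" "syl xs = h \<otimes>\<^bsub>F2\<^esub> w \<otimes>\<^bsub>F2\<^esub> inv\<^bsub>F2\<^esub> h"
    by (auto simp: conj_class_def)
  define k where "k = Suc (2 * length h)"
  have "k * Suc (length w) \<le> k * wlen xs" using less by (rule mult_le_mono2)
  also have "\<dots> = length (h \<otimes>\<^bsub>F2\<^esub> w [^]\<^bsub>F2\<^esub> k \<otimes>\<^bsub>F2\<^esub> inv\<^bsub>F2\<^esub> h)"
    using length_pow_normal_form[OF assms(1), of k] h w by (simp add: free_group.conj_pow)
  also have "\<dots> \<le> length h + k * length w + length h"
    using length_mult[of "h \<otimes>\<^bsub>F2\<^esub> w [^]\<^bsub>F2\<^esub> k" "inv\<^bsub>F2\<^esub> h"] length_mult[of h "w [^]\<^bsub>F2\<^esub> k"]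
      length_pow[of w k] length_inv[OF h(1)] by linarith
  finally show False by (simp add: k_def)
qed

lemma push_gen: "\<exists>n m. [x] = syl [(n, m)]"
proof (cases x)
  case (Pair g s)
  show ?thesis
  proof (cases g)
    case Gen_a
    have "[x] = syl [(if s then 1 else -1, 0)]"
      using pow_gen_a[of 1] pow_gen_a[of "-1"] by (auto simp: Pair Gen_a pw_def simp del: free_group.int_pow_1)
    then show ?thesis by blast
  next
    case Gen_b
    have "[x] = syl [(0, if s then 1 else -1)]"
      using pow_gen_b[of 1] pow_gen_b[of "-1"] by (auto simp: Pair Gen_b pw_def simp del: free_group.int_pow_1)
    then show ?thesis by blast
  qed
qed

lemma syl_surj: "w \<in> carrier F2 \<Longrightarrow> \<exists>xs. w = syl xs"
proof (induction w)
  case Nil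
  then show ?case by (metis one_free_group syl.simps(1))
next
  case (Cons x w)
  then have "reduced w" "reduced ([x] @ w)" by (auto simp: carrier_free_group reduced_Cons)
  then obtain xs where "w = syl xs"
    using Cons by (auto simp: carrier_free_group)
  then have "x # w = [x] \<otimes>\<^bsub>F2\<^esub> syl xs"
    using mult_eq_append[of "[x]" w] \<open>reduced ([x] @ w)\<close> by simp
  moreover obtain n m where "[x] = syl [(n, m)]" using push_gen by blast
  ultimately show ?case using syl_append[of "[(n, m)]" xs] by metis
qed

lemma exists_normal_form:
  assumes "W \<in> Conj F2"
  shows "\<exists>xs. normal_form xs \<and> W = cls xs"
proof -
  obtain xs0 where "W = cls xs0"
    using assms syl_surj by (auto simp: Conj_def cls_def)
  then have "\<exists>xs. W = cls xs \<and> (\<forall>ys. W = cls ys \<longrightarrow> length xs \<le> length ys)"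
    by (rule ex_has_least_nat)
  then obtain xs where xs: "W = cls xs" "\<And>ys. W = cls ys \<Longrightarrow> length xs \<le> length ys"
    by blast
  have "normal_form xs"
  proof (rule ccontr)
    assume nn: "\<not> normal_form xs"
    then have "xs \<noteq> []" by (simp add: normal_form_def)
    obtain n m where nm: "(n, m) \<in> set xs" "n = 0 \<or> m = 0"
      using nn by (auto simp: normal_form_def)
    then obtain us vs where us: "xs = us @ (n, m) # vs" by (meson split_list)
    define r where "r = vs @ us"
    have W: "W = cls ((n, m) # r)"
      using xs(1) us cls_rotate[of us "(n, m) # vs"] by (simp add: r_def)
    have len: "length xs = Suc (length r)" by (simp add: us r_def)
    show False
    proof (cases r)
      case Nil
      then have "xs = [(n, m)]" using us by (simp add: r_def)
      then have "n = 0" "m = 0" using nn nm(2) by (auto simp: normal_form_def)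
      then have "W = cls []" using W Nil by (simp add: cls_def)
      then show False using xs(2)[of "[]"] len by simp
    next
      case (Cons y r')
      show False
      proof (cases "m = 0")
        case True
        obtain n' m' where y: "y = (n', m')" by (cases y)
        have "syl ((n, m) # r) = syl ((n + n', m') # r')"
          by (simp add: Cons y True free_group.int_pow_mult free_group.m_assoc)
        then have "W = cls ((n + n', m') # r')" using W by (simp add: cls_def)
        then show False using xs(2) len Cons by fastforce
      next
        case False
        then have n: "n = 0" using nm by simp
        obtain r'' n' m' where r: "r = r'' @ [(n', m')]"
          using Cons by (metis list.distinct(1) rev_exhaust surj_pair)
        have "W = cls ((n', m') # (n, m) # r'')"
          using W cls_rotate[of "[(n', m')]" "(n, m) # r''"] by (simp add: r)
        moreover have "syl ((n', m') # (n, m) # r'') = syl ((n', m' + m) # r'')"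
          by (simp add: n free_group.int_pow_mult free_group.m_assoc)
        ultimately have "W = cls ((n', m' + m) # r'')" by (simp add: cls_def)
        then show False using xs(2) len r by fastforce
      qed
    qed
  qed
  then show ?thesis using xs(1) by blast
qed

lemma normal_forms_cls:
  assumes "W \<in> Conj F2" "xs \<in> normal_forms W"
  shows "W = cls xs"
  using assms free_group.Conj_conj_class[of W "syl xs"] by (simp add: normal_forms_def cls_def)

lemma cls_normal_forms:
  assumes "normal_form xs"
  shows "xs \<in> normal_forms (cls xs)"
  using assms free_group.conj_class_self[of "syl xs"] by (simp add: normal_forms_def cls_def)

lemma length_le_wlen:
  assumes "normal_form xs"
  shows "length xs \<le> wlen xs"
proof -
  have "\<forall>(n, m) \<in> set xs. n \<noteq> 0 \<or> m \<noteq> 0"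
    using assms by (auto simp: normal_form_def)
  then show ?thesis by (induction xs) auto
qed

lemma finite_normal_forms:
  assumes "W \<in> Conj F2"
  shows "finite (normal_forms W)"
proof -
  obtain zs where zs: "normal_form zs" "W = cls zs" using exists_normal_form[OF assms] by blast
  define N where "N = length (syl zs)"
  have "normal_forms W \<subseteq> {xs. set xs \<subseteq> {- int N..int N} \<times> {- int N..int N} \<and> length xs \<le> N}"
  proof safe
    fix xs assume xs: "xs \<in> normal_forms W"
    then have nf: "normal_form xs" by (simp add: normal_forms_def)
    have "syl zs \<in> cls xs"
      using normal_forms_cls[OF assms xs] zs cls_normal_forms[OF zs(1)] by (simp add: normal_forms_def)
    then have wl: "wlen xs \<le> N" using normal_form_minimal[OF nf] by (simp add: N_def)
    then show "length xs \<le> N" using length_le_wlen[OF nf] by simp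
    fix n m assume "(n, m) \<in> set xs"
    then have "nat \<bar>n\<bar> + nat \<bar>m\<bar> \<le> wlen xs"
      by (induction xs) auto
    then show "n \<in> {- int N..int N}" "m \<in> {- int N..int N}" using wl by auto
  qed
  then show ?thesis by (rule finite_subset) (intro finite_lists_length_le, auto)
qed

lemma exp_seq_inj: "length xs = length ys \<Longrightarrow> exp_seq xs = exp_seq ys \<Longrightarrow> xs = ys"
  by (induction xs ys rule: list_induct2) (auto simp: exp_seq_def)

lemma ex1_canonical:
  assumes "W \<in> Conj F2"
  shows "\<exists>!xs. is_canonical W xs"
proof -
  note fin = finite_normal_forms[OF assms]
  have ne: "normal_forms W \<noteq> {}" using exists_normal_form[OF assms] cls_normal_forms by blast
  define M where "M = Max (max_seq ` normal_forms W)"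
  have M: "M \<in> max_seq ` normal_forms W" "\<And>ys. ys \<in> normal_forms W \<Longrightarrow> max_seq ys \<le> M"
    using fin ne by (auto simp: M_def)
  define S where "S = {xs \<in> normal_forms W. max_seq xs = M}"
  have S: "finite S" "S \<noteq> {}" using M fin by (auto simp: S_def)
  then have "Max (exp_seq ` S) \<in> exp_seq ` S" by simp
  then obtain xs where xs: "xs \<in> S" "exp_seq xs = Max (exp_seq ` S)" by auto
  have "is_canonical W xs"
    using xs S M(2) by (auto simp: is_canonical_def S_def)
  moreover have "ys = zs" if "is_canonical W ys" "is_canonical W zs" for ys zs
  proof -
    have m: "max_seq ys = max_seq zs"
      using that by (intro antisym) (auto simp: is_canonical_def)
    then have e: "exp_seq ys = exp_seq zs"
      using that by (intro antisym) (auto simp: is_canonical_def)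
    have "length ys = length zs" using m by (metis length_map max_seq_def)
    then show ?thesis using e exp_seq_inj by blast
  qed
  ultimately show ?thesis by blast
qed

lemma is_canonical_canonical: "W \<in> Conj F2 \<Longrightarrow> is_canonical W (canonical W)"
  unfolding canonical_def by (rule theI') (rule ex1_canonical)

lemma normal_form_canonical: "W \<in> Conj F2 \<Longrightarrow> normal_form (canonical W)"
  using is_canonical_canonical by (auto simp: is_canonical_def normal_forms_def)

lemma cls_canonical: "W \<in> Conj F2 \<Longrightarrow> cls (canonical W) = W"
  using is_canonical_canonical normal_forms_cls by (auto simp: is_canonical_def)


section \<open>The polynomials attached to conjugacy classes\<close>

text \<open>Polynomials in $x, y, z$ are represented as iterated univariate polynomials
  $R[x][y][z]$, so that $z$ is the variable of the outermost layer.\<close>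

type_synonym 'a poly3 = "'a poly poly poly"

definition var_x :: "'a::comm_ring_1 poly3" where "var_x = [:[:[:0, 1:]:]:]"
definition var_y :: "'a::comm_ring_1 poly3" where "var_y = [:[:0, 1:]:]"
definition var_z :: "'a::comm_ring_1 poly3" where "var_z = [:0, 1:]"

definition equal_pair :: "(int \<times> int) list \<Rightarrow> nat \<Rightarrow> nat \<Rightarrow> bool" where
  "equal_pair xs i j \<longleftrightarrow> i < j \<and> j < length xs \<and> fst (xs ! i) = fst (xs ! j)"

text \<open>The value $0$ on sets of words that are not conjugacy classes is a dummy. In the last
  branch list positions count from $0$, so that \<open>take (j - i) (drop i xs)\<close> encodes
  $s_i \cdots s_{j-1}$. For a class $[b^m]$ the canonical list is \<open>[(0, m)]\<close>, so that the
  element $u$ of the second recursive branch is $1$, as it should be. Termination is by the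
  minimal word length in a class, which agrees with $l = l_a + l_b$.\<close>

function Phi :: "gen word set \<Rightarrow> 'a::comm_ring_1 poly3" where
  "Phi W =
    (if W \<notin> Conj F2 then 0
     else if W = cls [] then 2
     else if W \<in> {cls [(1, 0)], cls [(-1, 0)]} then var_x
     else if W \<in> {cls [(0, 1)], cls [(0, -1)]} then var_y
     else if W \<in> {cls [(1, 1)], cls [(-1, -1)]} then var_z
     else if W \<in> {cls [(-1, 1)], cls [(1, -1)]} then var_x * var_y - var_z
     else if W \<in> {cls [(1, 1), (-1, -1)], cls [(1, -1), (-1, 1)]} then
       var_x\<^sup>2 + var_y\<^sup>2 + var_z\<^sup>2 - var_x * var_y * var_z - 2
     else if W \<in> {cls [(1, 1), (-1, 1)], cls [(1, -1), (-1, -1)]} then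
       - var_x\<^sup>2 - var_z\<^sup>2 + var_x * var_y * var_z + 2
     else
       (let xs = canonical W; n = fst (hd xs); m = snd (hd xs) in
        if \<bar>n\<bar> \<ge> 2 then
          (let u = gen_b [^]\<^bsub>F2\<^esub> m \<otimes>\<^bsub>F2\<^esub> syl (tl xs) in
           var_x * Phi (conj_class F2 (gen_a [^]\<^bsub>F2\<^esub> (n - sgn n) \<otimes>\<^bsub>F2\<^esub> u))
             - Phi (conj_class F2 (gen_a [^]\<^bsub>F2\<^esub> (n - 2 * sgn n) \<otimes>\<^bsub>F2\<^esub> u)))
        else if \<bar>m\<bar> \<ge> 2 \<and> (\<bar>n\<bar> = 1 \<or> xs = [(0, m)]) then
          (let u = syl (tl xs) \<otimes>\<^bsub>F2\<^esub> gen_a [^]\<^bsub>F2\<^esub> n in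
           var_y * Phi (conj_class F2 (gen_b [^]\<^bsub>F2\<^esub> (m - sgn m) \<otimes>\<^bsub>F2\<^esub> u))
             - Phi (conj_class F2 (gen_b [^]\<^bsub>F2\<^esub> (m - 2 * sgn m) \<otimes>\<^bsub>F2\<^esub> u)))
        else
          (let i = (LEAST i. \<exists>j. equal_pair xs i j); j = (LEAST j. equal_pair xs i j);
               u = syl (take (j - i) (drop i xs)); v = syl (drop j xs @ take i xs) in
           Phi (conj_class F2 u) * Phi (conj_class F2 v)
             - Phi (conj_class F2 (inv\<^bsub>F2\<^esub> u \<otimes>\<^bsub>F2\<^esub> v)))))"
  by (pat_completeness, hypsubst, rule refl)

definition mu :: "gen word set \<Rightarrow> nat" where
  "mu W = (LEAST n. \<exists>w \<in> W. length w = n)"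

lemma mu_le: "w \<in> carrier F2 \<Longrightarrow> mu (conj_class F2 w) \<le> length w"
  unfolding mu_def
  by (rule Least_le[of "\<lambda>n. \<exists>w \<in> conj_class F2 w. length w = n"]) (use free_group.conj_class_self in blast)

lemma mu_canonical:
  assumes "W \<in> Conj F2"
  shows "mu W = wlen (canonical W)"
proof -
  define xs where "xs = canonical W"
  have xs: "normal_form xs" "W = cls xs"
    using normal_form_canonical[OF assms] cls_canonical[OF assms] by (simp_all add: xs_def)
  have "mu W \<le> wlen xs"
    using mu_le[of "syl xs"] length_syl_le[of xs] unfolding xs(2) cls_def by simp
  moreover have "syl xs \<in> W"
    using cls_normal_forms[OF xs(1)] unfolding xs(2)[symmetric] by (simp add: normal_forms_def)
  then have "\<exists>w \<in> W. length w = mu W"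
    unfolding mu_def using LeastI_ex[of "\<lambda>n. \<exists>w \<in> W. length w = n"] by blast
  then have "wlen xs \<le> mu W" using normal_form_minimal[OF xs(1)] xs(2) by metis
  ultimately show ?thesis by (simp add: xs_def)
qed

lemma canonical_unit_exponents:
  assumes W: "W \<in> Conj F2" and xs: "xs = canonical W" "xs \<noteq> []"
    and nm: "\<bar>fst (hd xs)\<bar> = 1" "\<bar>snd (hd xs)\<bar> = 1"
    and p: "p \<in> set xs"
  shows "p \<in> {1, -1} \<times> {1, -1}"
proof -
  have can: "is_canonical W xs" using is_canonical_canonical[OF W] xs by simp
  have nz: "all_nz xs"
    using normal_form_canonical[OF W] xs nm by (auto simp: normal_form_def all_nz_def)
  obtain us vs where us: "xs = us @ p # vs" using p by (meson split_list)
  define ys where "ys = p # vs @ us"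
  have ne: "all_nz ys" using nz us by (auto simp: all_nz_def ys_def)
  have "W = cls ys"
    using cls_canonical[OF W] xs cls_rotate[of us "p # vs"] us by (simp add: ys_def)
  then have "ys \<in> normal_forms W"
    using cls_normal_forms[of ys] ne by (auto simp: normal_form_def all_nz_def ys_def)
  then have "max_seq ys \<le> max_seq xs" using can by (auto simp: is_canonical_def)
  moreover obtain q qs where q: "xs = q # qs" using xs(2) by (meson neq_Nil_conv)
  ultimately have "max \<bar>fst p\<bar> \<bar>snd p\<bar> < max \<bar>fst q\<bar> \<bar>snd q\<bar> \<or>
      max \<bar>fst p\<bar> \<bar>snd p\<bar> = max \<bar>fst q\<bar> \<bar>snd q\<bar>"
    by (simp add: max_seq_def ys_def case_prod_unfold del: max_less_iff_conj) blast
  then have "max \<bar>fst p\<bar> \<bar>snd p\<bar> \<le> max \<bar>fst q\<bar> \<bar>snd q\<bar>" by linarith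
  then have "\<bar>fst p\<bar> \<le> 1" "\<bar>snd p\<bar> \<le> 1" using nm q by auto
  moreover have "fst p \<noteq> 0" "snd p \<noteq> 0" using nz p by (auto simp: all_nz_def)
  ultimately show ?thesis by (cases p) auto
qed

definition special :: "gen word set set" where
  "special = {cls [], cls [(1, 0)], cls [(-1, 0)], cls [(0, 1)], cls [(0, -1)],
     cls [(1, 1)], cls [(-1, -1)], cls [(-1, 1)], cls [(1, -1)],
     cls [(1, 1), (-1, -1)], cls [(1, -1), (-1, 1)],
     cls [(1, 1), (-1, 1)], cls [(1, -1), (-1, -1)]}"

lemma canonical_nonspecial:
  assumes W: "W \<in> Conj F2" "W \<notin> special" and xs: "xs = canonical W"
    and n: "\<not> 2 \<le> \<bar>fst (hd xs)\<bar>"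
    and m: "\<not> (2 \<le> \<bar>snd (hd xs)\<bar> \<and> (\<bar>fst (hd xs)\<bar> = 1 \<or> xs = [(0, snd (hd xs))]))"
  shows "set xs \<subseteq> {1, -1} \<times> {1, -1} \<and> (\<exists>i j. equal_pair xs i j)"
proof -
  have nf: "normal_form xs" and Wx: "W = cls xs"
    using normal_form_canonical[OF W(1)] cls_canonical[OF W(1)] xs by auto
  have sp: "ys \<noteq> xs" if "cls ys \<in> special" for ys
    using W(2) Wx that by blast
  have ne: "xs \<noteq> []" using sp[of "[]"] by (simp add: special_def)
  have unit: "k \<noteq> 1" "k \<noteq> -1" if "xs = [(k, 0)] \<or> xs = [(0, k)]" for k
    using sp[of "[(1, 0)]"] sp[of "[(-1, 0)]"] sp[of "[(0, 1)]"] sp[of "[(0, -1)]"] that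
    by (auto simp: special_def)
  have "xs \<noteq> [(k, 0)]" if "k \<noteq> 0" for k
  proof
    assume *: "xs = [(k, 0)]"
    have "\<not> 2 \<le> \<bar>k\<bar>" using n unfolding * by simp
    then show False using unit[of k] * that by linarith
  qed
  moreover have "xs \<noteq> [(0, k)]" if "k \<noteq> 0" for k
  proof
    assume *: "xs = [(0, k)]"
    have "\<not> 2 \<le> \<bar>k\<bar>" using m unfolding * by simp
    then show False using unit[of k] * that by linarith
  qed
  ultimately have nz: "all_nz xs" using nf unfolding normal_form_def all_nz_def[symmetric]
    using ne by metis
  have "fst (hd xs) \<noteq> 0" "snd (hd xs) \<noteq> 0"
    using nz hd_in_set[OF ne] by (auto simp: all_nz_def case_prod_unfold)
  then have h: "\<bar>fst (hd xs)\<bar> = 1" "\<bar>snd (hd xs)\<bar> = 1" using n m by linarith+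
  have sub: "set xs \<subseteq> {1, -1} \<times> {1, -1}"
    using canonical_unit_exponents[OF W(1) xs ne h] by blast
  have "\<exists>i j. equal_pair xs i j"
  proof (rule ccontr)
    assume "\<not> ?thesis"
    then have np: "\<not> equal_pair xs i j" for i j by blast
    obtain p ps where p: "xs = p # ps" using ne by (meson neq_Nil_conv)
    show False
    proof (cases ps)
      case Nil
      have "p \<in> {(1, 1), (1, -1), (-1, 1), (-1, -1)}" using sub p by auto
      then have "cls [p] \<in> special" by (elim insertE) (simp_all add: special_def)
      then show False using W Wx p Nil by simp
    next
      case (Cons q qs)
      have ne1: "fst p \<noteq> fst q" using np[of 0 1] p Cons by (auto simp: equal_pair_def)
      show False
      proof (cases qs)
        case Nil
        have sp: "cls [p', q'] \<in> special"
          if "p' \<in> {1, -1} \<times> {1, -1}" "q' \<in> {1, -1} \<times> {1, -1}" "fst p' = 1" "fst q' = -1" for p' q'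
        proof -
          have "p' \<in> {(1, 1), (1, -1)}" "q' \<in> {(-1, 1), (-1, -1)}" using that by auto
          then show ?thesis by (elim insertE) (simp_all add: special_def)
        qed
        have pq: "p \<in> {1, -1} \<times> {1, -1}" "q \<in> {1, -1} \<times> {1, -1}"
          using sub p Cons by auto
        then consider "fst p = 1" "fst q = -1" | "fst q = 1" "fst p = -1"
          using ne1 by fastforce
        then have "cls [p, q] \<in> special"
        proof cases
          case 1
          then show ?thesis using sp[OF pq] by blast
        next
          case 2
          then have "cls [q, p] \<in> special" using sp[OF pq(2,1)] by blast
          then show ?thesis using cls_rotate[of "[p]" "[q]"] by simp
        qed
        then show False using W Wx p Cons Nil by simp
      next
        case (Cons r rs)
        have "fst p \<noteq> fst r" "fst q \<noteq> fst r"
          using np[of 0 2] np[of 1 2] p \<open>ps = q # qs\<close> Cons by (auto simp: equal_pair_def)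
        moreover have "fst p \<in> {1, -1}" "fst q \<in> {1, -1}" "fst r \<in> {1, -1}"
          using sub p \<open>ps = q # qs\<close> Cons by auto
        ultimately show False using ne1 by auto
      qed
    qed
  qed
  then show ?thesis using sub by blast
qed

lemma least_equal_pair:
  assumes "\<exists>i j. equal_pair xs i j"
    and "i = (LEAST i. \<exists>j. equal_pair xs i j)" "j = (LEAST j. equal_pair xs i j)"
  shows "equal_pair xs i j"
proof -
  have "\<exists>j. equal_pair xs i j"
    unfolding assms(2) using LeastI_ex[of "\<lambda>i. \<exists>j. equal_pair xs i j", OF assms(1)] .
  then show ?thesis unfolding assms(3) by (rule LeastI_ex[of "equal_pair xs i"])
qed

lemma length_cancel:
  assumes "n \<noteq> 0"
  shows "length (inv\<^bsub>F2\<^esub> (syl ((n, m) # us)) \<otimes>\<^bsub>F2\<^esub> syl ((n, m') # vs))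
    < wlen ((n, m) # us) + wlen ((n, m') # vs)"
proof -
  define a where "a = gen_a [^]\<^bsub>F2\<^esub> n"
  define u where "u = syl ((0, m) # us)"
  define v where "v = syl ((0, m') # vs)"
  have c: "a \<in> carrier F2" "u \<in> carrier F2" "v \<in> carrier F2" by (simp_all add: a_def u_def v_def)
  have "syl ((n, m) # us) = a \<otimes>\<^bsub>F2\<^esub> u" "syl ((n, m') # vs) = a \<otimes>\<^bsub>F2\<^esub> v"
    by (simp_all add: a_def u_def v_def free_group.m_assoc)
  moreover have "inv\<^bsub>F2\<^esub> (a \<otimes>\<^bsub>F2\<^esub> u) \<otimes>\<^bsub>F2\<^esub> (a \<otimes>\<^bsub>F2\<^esub> v) = inv\<^bsub>F2\<^esub> u \<otimes>\<^bsub>F2\<^esub> (inv\<^bsub>F2\<^esub> a \<otimes>\<^bsub>F2\<^esub> a \<otimes>\<^bsub>F2\<^esub> v)"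
    using c by (simp only: free_group.inv_mult_group free_group.m_assoc free_group.inv_closed
        free_group.m_closed)
  moreover have "\<dots> = inv\<^bsub>F2\<^esub> u \<otimes>\<^bsub>F2\<^esub> v" using c by simp
  ultimately have eq: "inv\<^bsub>F2\<^esub> (syl ((n, m) # us)) \<otimes>\<^bsub>F2\<^esub> syl ((n, m') # vs) = inv\<^bsub>F2\<^esub> u \<otimes>\<^bsub>F2\<^esub> v"
    by metis
  have "length (inv\<^bsub>F2\<^esub> u \<otimes>\<^bsub>F2\<^esub> v) \<le> length u + length v"
    using length_mult[of "inv\<^bsub>F2\<^esub> u" v] length_inv[OF c(2)] by simp
  also have "\<dots> \<le> wlen ((0, m) # us) + wlen ((0, m') # vs)"
    unfolding u_def v_def by (intro add_mono length_syl_le)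
  also have "\<dots> < wlen ((n, m) # us) + wlen ((n, m') # vs)"
    using assms by simp
  finally show ?thesis unfolding eq .
qed

lemma mu_less:
  assumes "W \<in> Conj F2" "w \<in> carrier F2" "length w < wlen (canonical W)"
  shows "mu (conj_class F2 w) < mu W"
  using mu_le[OF assms(2)] mu_canonical[OF assms(1)] assms(3) by simp

lemma length_mult3:
  "length (u \<otimes>\<^bsub>F2\<^esub> (v \<otimes>\<^bsub>F2\<^esub> w)) \<le> length u + (length v + length w)"
  using length_mult[of u "v \<otimes>\<^bsub>F2\<^esub> w"] length_mult[of v w] by linarith

lemma canonical_Cons:
  assumes "W \<in> Conj F2" "W \<noteq> cls []"
  shows "canonical W = (fst (hd (canonical W)), snd (hd (canonical W))) # tl (canonical W)"
  using assms cls_canonical[OF assms(1)] by (cases "canonical W") auto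

lemma mu_less_a:
  assumes W: "W \<in> Conj F2" "W \<noteq> cls []" and xs: "xs = canonical W"
    and k: "\<bar>k\<bar> < \<bar>fst (hd xs)\<bar>"
  shows "mu (conj_class F2 (gen_a [^]\<^bsub>F2\<^esub> (k::int) \<otimes>\<^bsub>F2\<^esub>
    (gen_b [^]\<^bsub>F2\<^esub> snd (hd xs) \<otimes>\<^bsub>F2\<^esub> syl (tl xs)))) < mu W"
proof (rule mu_less[OF W(1)])
  have "wlen (canonical W) = nat \<bar>fst (hd xs)\<bar> + nat \<bar>snd (hd xs)\<bar> + wlen (tl xs)"
    using canonical_Cons[OF W] wlen_simps(2) xs by metis
  then show "length (gen_a [^]\<^bsub>F2\<^esub> k \<otimes>\<^bsub>F2\<^esub> (gen_b [^]\<^bsub>F2\<^esub> snd (hd xs) \<otimes>\<^bsub>F2\<^esub> syl (tl xs)))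
    < wlen (canonical W)"
    using length_mult3[of "gen_a [^]\<^bsub>F2\<^esub> k" "gen_b [^]\<^bsub>F2\<^esub> snd (hd xs)" "syl (tl xs)"]
      length_syl_le[of "tl xs"] k unfolding pow_gen_a pow_gen_b length_pw by linarith
qed simp

lemma mu_less_b:
  assumes W: "W \<in> Conj F2" "W \<noteq> cls []" and xs: "xs = canonical W"
    and k: "\<bar>k\<bar> < \<bar>snd (hd xs)\<bar>"
  shows "mu (conj_class F2 (gen_b [^]\<^bsub>F2\<^esub> (k::int) \<otimes>\<^bsub>F2\<^esub>
    (syl (tl xs) \<otimes>\<^bsub>F2\<^esub> gen_a [^]\<^bsub>F2\<^esub> fst (hd xs)))) < mu W"
proof (rule mu_less[OF W(1)])
  have "wlen (canonical W) = nat \<bar>fst (hd xs)\<bar> + nat \<bar>snd (hd xs)\<bar> + wlen (tl xs)"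
    using canonical_Cons[OF W] wlen_simps(2) xs by metis
  then show "length (gen_b [^]\<^bsub>F2\<^esub> k \<otimes>\<^bsub>F2\<^esub> (syl (tl xs) \<otimes>\<^bsub>F2\<^esub> gen_a [^]\<^bsub>F2\<^esub> fst (hd xs)))
    < wlen (canonical W)"
    using length_mult3[of "gen_b [^]\<^bsub>F2\<^esub> k" "syl (tl xs)" "gen_a [^]\<^bsub>F2\<^esub> fst (hd xs)"]
      length_syl_le[of "tl xs"] k unfolding pow_gen_a pow_gen_b length_pw by linarith
qed simp

lemma mu_less_uv:
  assumes W: "W \<in> Conj F2" "W \<notin> special" and xs: "xs = canonical W"
    and n: "\<not> 2 \<le> \<bar>fst (hd xs)\<bar>"
    and m: "\<not> (2 \<le> \<bar>snd (hd xs)\<bar> \<and> (\<bar>fst (hd xs)\<bar> = 1 \<or> xs = [(0, snd (hd xs))]))"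
    and i: "i = (LEAST i. \<exists>j. equal_pair xs i j)" and j: "j = (LEAST j. equal_pair xs i j)"
    and u: "u = syl (take (j - i) (drop i xs))" and v: "v = syl (drop j xs @ take i xs)"
  shows "mu (conj_class F2 u) < mu W" "mu (conj_class F2 v) < mu W"
    "mu (conj_class F2 (inv\<^bsub>F2\<^esub> u \<otimes>\<^bsub>F2\<^esub> v)) < mu W"
proof -
  note ns = canonical_nonspecial[OF W xs n m]
  have ep: "equal_pair xs i j" using least_equal_pair[OF conjunct2[OF ns] i j] .
  then have ij: "i < j" "j < length xs" "fst (xs ! i) = fst (xs ! j)" by (auto simp: equal_pair_def)
  have 1: "take (j - i) (drop i xs) = xs ! i # take (j - Suc i) (drop (Suc i) xs)"
  proof -
    have "drop i xs = xs ! i # drop (Suc i) xs" "j - i = Suc (j - Suc i)"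
      using ij by (simp_all add: Cons_nth_drop_Suc)
    then show ?thesis by (metis take_Suc_Cons)
  qed
  have 2: "drop j xs @ take i xs = xs ! j # drop (Suc j) xs @ take i xs"
    using Cons_nth_drop_Suc[OF ij(2)] by (metis append_Cons)
  have "xs = take i xs @ take (j - i) (drop i xs) @ drop j xs"
  proof -
    have "drop j xs = drop (j - i) (drop i xs)" using ij by simp
    then show ?thesis by (metis append_take_drop_id)
  qed
  then have "wlen xs = wlen (take i xs) + wlen (take (j - i) (drop i xs)) + wlen (drop j xs)"
    by (metis add.assoc wlen_simps(3))
  then have tot: "wlen xs = wlen (take (j - i) (drop i xs)) + wlen (drop j xs @ take i xs)"
    by simp
  have "fst (xs ! i) \<in> {1, -1}" 
  proof -
    have "xs ! i \<in> set xs" using ij by simp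
    then have "xs ! i \<in> {1, -1} \<times> {1, -1}" using ns by blast
    then show ?thesis by (simp only: mem_Times_iff)
  qed
  then obtain n k k' where p: "xs ! i = (n, k)" "xs ! j = (n, k')" "n \<noteq> 0"
  proof -
    have "xs ! i = (fst (xs ! i), snd (xs ! i))" "xs ! j = (fst (xs ! i), snd (xs ! j))"
      by (rule prod.collapse[symmetric]) (metis ij(3) prod.collapse)
    moreover have "fst (xs ! i) \<noteq> 0" using \<open>fst (xs ! i) \<in> {1, -1}\<close> by auto
    ultimately show thesis using that by blast
  qed
  have pos: "0 < wlen (take (j - i) (drop i xs))" "0 < wlen (drop j xs @ take i xs)"
    unfolding 1 2 using p by simp_all
  show "mu (conj_class F2 u) < mu W"
  proof (rule mu_less[OF W(1)])
    show "u \<in> carrier F2" unfolding u by (rule syl_closed)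
    show "length u < wlen (canonical W)"
      using length_syl_le[of "take (j - i) (drop i xs)"] pos tot unfolding u xs[symmetric] by linarith
  qed
  show "mu (conj_class F2 v) < mu W"
  proof (rule mu_less[OF W(1)])
    show "v \<in> carrier F2" unfolding v by (rule syl_closed)
    show "length v < wlen (canonical W)"
      using length_syl_le[of "drop j xs @ take i xs"] pos tot unfolding v xs[symmetric] by linarith
  qed
  have "length (inv\<^bsub>F2\<^esub> u \<otimes>\<^bsub>F2\<^esub> v) < wlen xs"
    unfolding tot u v unfolding 1 2 p(1,2) by (rule length_cancel[OF p(3)])
  then show "mu (conj_class F2 (inv\<^bsub>F2\<^esub> u \<otimes>\<^bsub>F2\<^esub> v)) < mu W"
    unfolding xs u v
    by (intro mu_less[OF W(1)] free_group.m_closed free_group.inv_closed syl_closed)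
qed

lemma notin_special:
  assumes "W \<noteq> cls []" "W \<notin> {cls [(1, 0)], cls [(-1, 0)]}" "W \<notin> {cls [(0, 1)], cls [(0, -1)]}"
    "W \<notin> {cls [(1, 1)], cls [(-1, -1)]}" "W \<notin> {cls [(-1, 1)], cls [(1, -1)]}"
    "W \<notin> {cls [(1, 1), (-1, -1)], cls [(1, -1), (-1, 1)]}"
    "W \<notin> {cls [(1, 1), (-1, 1)], cls [(1, -1), (-1, -1)]}"
  shows "W \<notin> special"
  using assms unfolding special_def by blast

lemma abs_sgn_less:
  fixes n :: int
  assumes "2 \<le> \<bar>n\<bar>"
  shows "\<bar>n - sgn n\<bar> < \<bar>n\<bar>" "\<bar>n - 2 * sgn n\<bar> < \<bar>n\<bar>"
  using assms by (auto simp: sgn_if)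

termination Phi
proof (relation "measure mu", goal_cases)
  case 1
  show ?case by (rule wf_measure)
next
  case (2 W xs n m u)
  then show ?case
    unfolding in_measure by hypsubst (rule mu_less_a[OF notnotD _ refl abs_sgn_less(1)])
next
  case (3 W xs n m u)
  then show ?case
    unfolding in_measure by hypsubst (rule mu_less_a[OF notnotD _ refl abs_sgn_less(2)])
next
  case (4 W xs n m u)
  then show ?case
    unfolding in_measure by hypsubst (rule mu_less_b[OF notnotD _ refl abs_sgn_less(1)[OF conjunct1]])
next
  case (5 W xs n m u)
  then show ?case
    unfolding in_measure by hypsubst (rule mu_less_b[OF notnotD _ refl abs_sgn_less(2)[OF conjunct1]])
next
  case (6 W xs n m i j u v)
  then show ?case
    unfolding in_measure by hypsubst (rule mu_less_uv(1)[OF notnotD notin_special refl _ _ refl refl refl refl])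
next
  case (7 W xs n m i j u v)
  then show ?case
    unfolding in_measure by hypsubst (rule mu_less_uv(2)[OF notnotD notin_special refl _ _ refl refl refl refl])
next
  case (8 W xs n m i j u v)
  then show ?case
    unfolding in_measure by hypsubst (rule mu_less_uv(3)[OF notnotD notin_special refl _ _ refl refl refl refl])
qed

declare Phi.simps [simp del]

subsection \<open>Coefficients in the prime ring\<close>

definition prime_ring :: "'a::comm_ring_1 set" where
  "prime_ring = \<Inter>{S. 1 \<in> S \<and> (\<forall>x\<in>S. \<forall>y\<in>S. x - y \<in> S \<and> x * y \<in> S)}"

definition polys_over :: "'a::zero set \<Rightarrow> 'a poly set" where
  "polys_over S = {p. \<forall>i. coeff p i \<in> S}"

definition is_subring :: "'a::comm_ring_1 set \<Rightarrow> bool" where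
  "is_subring S \<longleftrightarrow> 1 \<in> S \<and> (\<forall>x\<in>S. \<forall>y\<in>S. x - y \<in> S \<and> x * y \<in> S)"

lemma is_subringD:
  assumes "is_subring S"
  shows "1 \<in> S" "0 \<in> S" "x \<in> S \<Longrightarrow> y \<in> S \<Longrightarrow> x - y \<in> S" "x \<in> S \<Longrightarrow> y \<in> S \<Longrightarrow> x * y \<in> S"
    "x \<in> S \<Longrightarrow> - x \<in> S" "x \<in> S \<Longrightarrow> y \<in> S \<Longrightarrow> x + y \<in> S"
proof -
  show "1 \<in> S" using assms by (auto simp: is_subring_def)
  show d: "x \<in> S \<Longrightarrow> y \<in> S \<Longrightarrow> x - y \<in> S" for x y using assms by (auto simp: is_subring_def)
  show "x \<in> S \<Longrightarrow> y \<in> S \<Longrightarrow> x * y \<in> S" using assms by (auto simp: is_subring_def)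
  show z: "0 \<in> S" using d[OF \<open>1 \<in> S\<close> \<open>1 \<in> S\<close>] by simp
  show m: "x \<in> S \<Longrightarrow> - x \<in> S" for x using d[OF z] by fastforce
  show "x \<in> S \<Longrightarrow> y \<in> S \<Longrightarrow> x + y \<in> S" using d m by fastforce
qed

lemma is_subring_prime_ring: "is_subring prime_ring"
  by (auto simp: is_subring_def prime_ring_def)

lemma is_subring_polys_over:
  assumes S: "is_subring S"
  shows "is_subring (polys_over S)"
proof -
  have sum: "finite T \<Longrightarrow> (\<And>i. i \<in> T \<Longrightarrow> f i \<in> S) \<Longrightarrow> sum f T \<in> S" for T :: "nat set" and f
    by (induction T rule: finite_induct) (auto intro: is_subringD[OF S])
  show ?thesis
    unfolding is_subring_def polys_over_def
    by (auto simp: coeff_mult coeff_1 intro!: is_subringD[OF S] sum)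
qed

lemma is_subring_2: "is_subring S \<Longrightarrow> 2 \<in> S"
  by (metis is_subringD(1,6) one_add_one)

lemma polys_over_pCons: "a \<in> S \<Longrightarrow> p \<in> polys_over S \<Longrightarrow> pCons a p \<in> polys_over S"
  by (auto simp: polys_over_def coeff_pCons split: nat.splits)

lemma Phi_polys_over_prime_ring:
  "(Phi W :: 'a::comm_ring_1 poly3) \<in> polys_over (polys_over (polys_over prime_ring))"
proof -
  let ?P = "polys_over (polys_over (polys_over prime_ring)) :: 'a poly3 set"
  note sr = is_subring_prime_ring is_subring_polys_over
  have R: "is_subring ?P" by (intro sr)
  have vars: "var_x \<in> ?P" "var_y \<in> ?P" "var_z \<in> ?P"
    unfolding var_x_def var_y_def var_z_def
    by (intro polys_over_pCons is_subringD(1,2) sr)+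
  note closure = is_subringD(2-6)[OF R] is_subring_2[OF R] vars
  have if_mem: "(c \<Longrightarrow> p \<in> ?P) \<Longrightarrow> (\<not> c \<Longrightarrow> q \<in> ?P) \<Longrightarrow> (if c then p else q) \<in> ?P" for c p q
    by simp
  show ?thesis
  proof (induction W rule: measure_induct_rule[of mu])
    case (less W)
    show ?case
      unfolding Phi.simps[of W] Let_def power2_eq_square
    proof (intro if_mem closure, goal_cases)
      case 1
      then show ?case
        by (intro less mu_less_a[OF notnotD _ refl abs_sgn_less(1)])
    next
      case 2
      then show ?case
        by (intro less mu_less_a[OF notnotD _ refl abs_sgn_less(2)])
    next
      case 3
      then show ?case
        by (intro less mu_less_b[OF notnotD _ refl abs_sgn_less(1)[OF conjunct1]])
    next
      case 4
      then show ?case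
        by (intro less mu_less_b[OF notnotD _ refl abs_sgn_less(2)[OF conjunct1]])
    next
      case 5
      then show ?case
        by (intro less mu_less_uv(1)[OF notnotD notin_special refl _ _ refl refl refl refl])
    next
      case 6
      then show ?case
        by (intro less mu_less_uv(2)[OF notnotD notin_special refl _ _ refl refl refl refl])
    next
      case 7
      then show ?case
        by (intro less mu_less_uv(3)[OF notnotD notin_special refl _ _ refl refl refl refl])
    qed
  qed
qed

section \<open>Valuations and substitution\<close>

definition nonarch_valuation :: "('l::field \<Rightarrow> real) \<Rightarrow> bool" where
  "nonarch_valuation v \<longleftrightarrow>
     (\<forall>x. 0 \<le> v x) \<and> (\<forall>x. v x = 0 \<longleftrightarrow> x = 0) \<and>
     (\<forall>x y. v (x * y) = v x * v y) \<and> (\<forall>x y. v (x + y) \<le> max (v x) (v y))"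

definition trivial_on :: "('l::field \<Rightarrow> real) \<Rightarrow> 'l set \<Rightarrow> bool" where
  "trivial_on v S \<longleftrightarrow> (\<forall>x\<in>S. x \<noteq> 0 \<longrightarrow> v x = 1)"

definition of_const :: "'k::field \<Rightarrow> 'k poly fract" where
  "of_const c = to_fract [:c:]"

text \<open>\<open>subst3 P f g h\<close> substitutes $x = f$, $y = g$, $z = h$; the innermost layer is the one
  in $x$.\<close>

definition subst3 :: "'k::field poly3 \<Rightarrow> 'k poly fract \<Rightarrow> 'k poly fract \<Rightarrow> 'k poly fract \<Rightarrow> 'k poly fract"
  where
  "subst3 P f g h =
     poly (map_poly (\<lambda>Q. poly (map_poly (\<lambda>R. poly (map_poly of_const R) f) Q) g) P) h"

definition Psi :: "'k::field poly fract \<Rightarrow> 'k poly fract \<Rightarrow> 'k poly fract \<Rightarrow> gen word set \<Rightarrow> 'k poly fract"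
  where
  "Psi f g h W = subst3 (Phi W) f g h"

end

theory Submission
  imports Defs
begin

text \<open>In each recursive step of \<open>Phi\<close> the first term realises the full bidegree
  \<open>(l_a W, l_b W)\<close>, whereas the class in the subtracted term is represented by a word with
  fewer letters of one generator and no more of the other. The former therefore dominates strictly
  with respect to the valuation. For this the numbers \<open>l_a\<close> and \<open>l_b\<close> must be bounded by the letter
  counts of arbitrary representatives, which follows by comparing the letter counts of
  $(h w h^{-1})^k$ for large $k$. For the two special quartic classes the dominant part is
  $\pm h (h - f g)$.\<close>

section \<open>Counting the letters of one generator\<close>

definition gen_count :: "'g \<Rightarrow> 'g word \<Rightarrow> nat" where
  "gen_count c w = length (filter (\<lambda>x. fst x = c) w)"

definition exp_sum :: "gen \<Rightarrow> (int \<times> int) list \<Rightarrow> nat" where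
  "exp_sum c xs = (\<Sum>p \<leftarrow> xs. nat \<bar>case c of Gen_a \<Rightarrow> fst p | Gen_b \<Rightarrow> snd p\<bar>)"

text \<open>Both lengths as one function of the generator, so that each bound is proved once for
  \<open>l_a\<close> and \<open>l_b\<close>.\<close>

definition class_len :: "gen \<Rightarrow> gen word set \<Rightarrow> nat" where
  "class_len c W = exp_sum c (canonical W)"

lemma l_a_class_len: "l_a W = class_len Gen_a W"
  and l_b_class_len: "l_b W = class_len Gen_b W"
  by (simp_all add: l_a_def l_b_def class_len_def exp_sum_def case_prod_unfold)

lemma exp_sum_simps [simp]:
  "exp_sum c [] = 0"
  "exp_sum c (p # xs) = nat \<bar>case c of Gen_a \<Rightarrow> fst p | Gen_b \<Rightarrow> snd p\<bar> + exp_sum c xs"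
  "exp_sum c (xs @ ys) = exp_sum c xs + exp_sum c ys"
  by (simp_all add: exp_sum_def)

lemma exp_sum_replicate: "exp_sum c (concat (replicate k xs)) = k * exp_sum c xs"
  by (induction k) auto

lemma wlen_exp_sum: "wlen xs = exp_sum Gen_a xs + exp_sum Gen_b xs"
  by (induction xs) auto

lemma length_gen_count: "length w = gen_count Gen_a w + gen_count Gen_b w"
proof (induction w)
  case (Cons x w)
  then show ?case by (cases "fst x") (auto simp: gen_count_def)
qed (simp add: gen_count_def)

lemma gen_count_push: "gen_count c (push x w) \<le> gen_count c [x] + gen_count c w"
  by (cases w) (auto simp: gen_count_def)

lemma gen_count_foldr_push: "gen_count c (foldr push u v) \<le> gen_count c u + gen_count c v"
proof (induction u)
  case (Cons x u)
  then show ?case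
    using gen_count_push[of c x "foldr push u v"] by (auto simp: gen_count_def)
qed (simp add: gen_count_def)

lemma gen_count_mult: "gen_count c (u \<otimes>\<^bsub>free_group\<^esub> v) \<le> gen_count c u + gen_count c v"
  using gen_count_foldr_push[of c "u @ v" "[]"]
  by (simp add: free_group_def reduce_def gen_count_def)

lemma gen_count_inv:
  "w \<in> carrier free_group \<Longrightarrow> gen_count c (inv\<^bsub>free_group\<^esub> w) = gen_count c w"
  by (simp add: carrier_free_group inv_free_group gen_count_def rev_filter[symmetric] filter_map
      o_def flip_def)

lemma gen_count_pow: "gen_count c (w [^]\<^bsub>free_group\<^esub> (k::nat)) \<le> k * gen_count c w"
proof (induction k)
  case (Suc k)
  then show ?case using gen_count_mult[of c "w [^]\<^bsub>free_group\<^esub> k" w] by simp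
qed (simp add: one_free_group gen_count_def)

section \<open>Letter counts of syllable words, their powers and their conjugates\<close>

lemma gen_count_pw: "gen_count c (pw d n) = (if d = c then nat \<bar>n\<bar> else 0)"
  by (simp add: gen_count_def pw_def)

lemma gen_count_syl_le: "gen_count c (syl xs) \<le> exp_sum c xs"
proof (induction xs rule: syl.induct)
  case (2 n m xs)
  have "gen_count c (syl ((n, m) # xs))
      \<le> gen_count c (pw Gen_a n) + gen_count c (pw Gen_b m) + gen_count c (syl xs)"
    unfolding syl.simps pow_gen_a pow_gen_b by (meson add_right_mono le_trans gen_count_mult)
  then show ?case using 2 by (cases c) (simp_all add: gen_count_pw)
qed (simp add: one_free_group gen_count_def)

text \<open>Each count is at most \<open>k * exp_sum\<close>, and the two counts add up to the
  length, which is exactly \<open>k * wlen xs\<close>. Hence neither bound can be strict.\<close>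

lemma gen_count_pow_normal_form:
  assumes "normal_form xs"
  shows "gen_count c (syl xs [^]\<^bsub>F2\<^esub> (k::nat)) = k * exp_sum c xs"
proof -
  let ?w = "syl xs [^]\<^bsub>F2\<^esub> k"
  have le: "gen_count d ?w \<le> k * exp_sum d xs" for d
    using gen_count_syl_le[of d "concat (replicate k xs)"] by (simp add: syl_pow exp_sum_replicate)
  have "gen_count Gen_a ?w + gen_count Gen_b ?w = k * exp_sum Gen_a xs + k * exp_sum Gen_b xs"
    using length_pow_normal_form[OF assms, of k] length_gen_count[of ?w]
    by (simp add: wlen_exp_sum distrib_left)
  then show ?thesis using le[of Gen_a] le[of Gen_b] by (cases c) auto
qed

text \<open>Conjugation by \<open>h\<close> adds at most \<open>2 * gen_count c h\<close> letters to
  a power of \<open>w\<close>, whatever its exponent \<open>k\<close>, whereas a deficit of one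
  letter per factor grows with \<open>k\<close>.\<close>

lemma exp_sum_minimal:
  assumes "normal_form xs" "w \<in> cls xs"
  shows "exp_sum c xs \<le> gen_count c w"
proof (rule ccontr)
  assume "\<not> exp_sum c xs \<le> gen_count c w"
  then have less: "Suc (gen_count c w) \<le> exp_sum c xs" by simp
  have w: "w \<in> carrier F2" using assms(2) free_group.Conj_carrier[of "cls xs" w] by simp
  have "syl xs \<in> conj_class F2 w"
    using assms(2) free_group.conj_class_sym[of "syl xs" w] by (simp add: cls_def)
  then obtain h where h: "h \<in> carrier F2" "syl xs = h \<otimes>\<^bsub>F2\<^esub> w \<otimes>\<^bsub>F2\<^esub> inv\<^bsub>F2\<^esub> h"
    by (auto simp: conj_class_def)
  \<comment> \<open>One more than the number of letters \<open>c\<close> that \<open>h\<close> and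
    its inverse can contribute together.\<close>
  define k where "k = Suc (2 * gen_count c h)"
  have "k * Suc (gen_count c w) \<le> k * exp_sum c xs" using less by (rule mult_le_mono2)
  also have "\<dots> = gen_count c (h \<otimes>\<^bsub>F2\<^esub> w [^]\<^bsub>F2\<^esub> k \<otimes>\<^bsub>F2\<^esub> inv\<^bsub>F2\<^esub> h)"
    using gen_count_pow_normal_form[OF assms(1), of c k] h w by (simp add: free_group.conj_pow)
  also have "\<dots> \<le> gen_count c h + k * gen_count c w + gen_count c h"
    using gen_count_mult[of c "h \<otimes>\<^bsub>F2\<^esub> w [^]\<^bsub>F2\<^esub> k" "inv\<^bsub>F2\<^esub> h"] gen_count_mult[of c h "w [^]\<^bsub>F2\<^esub> k"]
      gen_count_pow[of c w k] gen_count_inv[OF h(1), of c] by linarith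
  finally show False by (simp add: k_def)
qed

lemma class_len_le:
  assumes "w \<in> carrier F2"
  shows "class_len c (conj_class F2 w) \<le> gen_count c w"
proof -
  have "conj_class F2 w \<in> Conj F2" using assms by (simp add: Conj_def)
  then show ?thesis
    unfolding class_len_def
    using exp_sum_minimal[OF normal_form_canonical, of "conj_class F2 w" w c]
      cls_canonical[of "conj_class F2 w"] free_group.conj_class_self[OF assms] by simp
qed

lemma class_len_cls_le: "class_len c (cls xs) \<le> exp_sum c xs"
  using class_len_le[of "syl xs" c] gen_count_syl_le[of c xs] by (simp add: cls_def)

text \<open>Lengths can be read off any normal form, so in the recursion it does not matter which
  representative of a smaller class is the canonical one.\<close>

lemma class_len_normal_form:
  assumes "normal_form xs"
  shows "class_len c (cls xs) = exp_sum c xs"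
proof (rule antisym[OF class_len_cls_le])
  let ?ys = "canonical (cls xs)"
  have "syl ?ys \<in> cls xs"
    using cls_normal_forms[OF normal_form_canonical[of "cls xs"]] cls_canonical[of "cls xs"]
    by (simp add: normal_forms_def)
  then show "exp_sum c xs \<le> class_len c (cls xs)"
    using exp_sum_minimal[OF assms, of _ c] gen_count_syl_le[of c ?ys]
    unfolding class_len_def by (meson le_trans)
qed

text \<open>The common initial power \<open>a^n\<close> cancels in the middle of the product, so
  both leading \<open>a\<close>-exponents may be counted as zero.\<close>

lemma gen_count_cancel:
  "gen_count c (inv\<^bsub>F2\<^esub> (syl ((n, m) # us)) \<otimes>\<^bsub>F2\<^esub> syl ((n, m') # vs))
    \<le> exp_sum c ((0, m) # us) + exp_sum c ((0, m') # vs)"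
proof -
  define a where "a = gen_a [^]\<^bsub>F2\<^esub> n"
  define u where "u = syl ((0, m) # us)"
  define v where "v = syl ((0, m') # vs)"
  have c: "a \<in> carrier F2" "u \<in> carrier F2" "v \<in> carrier F2" by (simp_all add: a_def u_def v_def)
  have "syl ((n, m) # us) = a \<otimes>\<^bsub>F2\<^esub> u" "syl ((n, m') # vs) = a \<otimes>\<^bsub>F2\<^esub> v"
    by (simp_all add: a_def u_def v_def free_group.m_assoc)
  moreover have "inv\<^bsub>F2\<^esub> (a \<otimes>\<^bsub>F2\<^esub> u) \<otimes>\<^bsub>F2\<^esub> (a \<otimes>\<^bsub>F2\<^esub> v) = inv\<^bsub>F2\<^esub> u \<otimes>\<^bsub>F2\<^esub> (inv\<^bsub>F2\<^esub> a \<otimes>\<^bsub>F2\<^esub> a \<otimes>\<^bsub>F2\<^esub> v)"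
    using c by (simp only: free_group.inv_mult_group free_group.m_assoc free_group.inv_closed
        free_group.m_closed)
  moreover have "\<dots> = inv\<^bsub>F2\<^esub> u \<otimes>\<^bsub>F2\<^esub> v" using c by simp
  ultimately have eq: "inv\<^bsub>F2\<^esub> (syl ((n, m) # us)) \<otimes>\<^bsub>F2\<^esub> syl ((n, m') # vs) = inv\<^bsub>F2\<^esub> u \<otimes>\<^bsub>F2\<^esub> v"
    by metis
  have "gen_count c (inv\<^bsub>F2\<^esub> u \<otimes>\<^bsub>F2\<^esub> v) \<le> gen_count c u + gen_count c v"
    using gen_count_mult[of c "inv\<^bsub>F2\<^esub> u" v] gen_count_inv[OF c(2)] by simp
  also have "\<dots> \<le> exp_sum c ((0, m) # us) + exp_sum c ((0, m') # vs)"
    unfolding u_def v_def by (intro add_mono gen_count_syl_le)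
  finally show ?thesis unfolding eq .
qed


section \<open>Substitution as a ring homomorphism\<close>

definition is_ring_hom :: "('a::comm_ring_1 \<Rightarrow> 'b::comm_ring_1) \<Rightarrow> bool" where
  "is_ring_hom \<phi> \<longleftrightarrow>
     \<phi> 1 = 1 \<and> (\<forall>x y. \<phi> (x + y) = \<phi> x + \<phi> y) \<and> (\<forall>x y. \<phi> (x * y) = \<phi> x * \<phi> y)"

lemma is_ring_homD:
  assumes "is_ring_hom \<phi>"
  shows "\<phi> 1 = 1" "\<phi> (x + y) = \<phi> x + \<phi> y" "\<phi> (x * y) = \<phi> x * \<phi> y" "\<phi> 0 = 0"
    "\<phi> (- x) = - \<phi> x" "\<phi> (x - y) = \<phi> x - \<phi> y" "\<phi> 2 = 2" "\<phi> (x\<^sup>2) = (\<phi> x)\<^sup>2"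
proof -
  show one: "\<phi> 1 = 1" using assms by (simp add: is_ring_hom_def)
  show add: "\<phi> (x + y) = \<phi> x + \<phi> y" for x y using assms by (simp add: is_ring_hom_def)
  show mult: "\<phi> (x * y) = \<phi> x * \<phi> y" for x y using assms by (simp add: is_ring_hom_def)
  show zero: "\<phi> 0 = 0" using add[of 0 0] by simp
  show minus: "\<phi> (- x) = - \<phi> x" for x
    using add[of "- x" x] zero by (simp add: eq_neg_iff_add_eq_0)
  show "\<phi> (x - y) = \<phi> x - \<phi> y" using add[of x "- y"] minus by simp
  show "\<phi> 2 = 2" using add[of 1 1] one by simp
  show "\<phi> (x\<^sup>2) = (\<phi> x)\<^sup>2" by (simp add: power2_eq_square mult)
qed

text \<open>One layer of substitution: a homomorphism on coefficients extends by evaluation at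
  \<open>c\<close>. Three applications, starting from \<open>of_const\<close>, give
  \<open>subst3\<close>.\<close>

lemma is_ring_hom_poly_map_poly:
  assumes \<phi>: "is_ring_hom \<phi>"
  shows "is_ring_hom (\<lambda>P. poly (map_poly \<phi> P) c)"
proof -
  note hom = is_ring_homD[OF \<phi>]
  let ?e = "\<lambda>P. poly (map_poly \<phi> P) c"
  have pc: "?e (pCons a P) = \<phi> a + c * ?e P" for a P
    by (simp add: map_poly_pCons hom)
  have add: "?e (P + Q) = ?e P + ?e Q" for P Q
    by (induction P Q rule: poly_induct2) (simp_all add: pc hom algebra_simps)
  have smult: "?e (smult a P) = \<phi> a * ?e P" for a P
    by (induction P) (simp_all add: pc hom algebra_simps)
  have "?e (P * Q) = ?e P * ?e Q" for P Q
    by (induction P) (simp_all add: add smult pc hom algebra_simps)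
  moreover have "?e 1 = 1" by (simp add: one_pCons pc hom)
  ultimately show ?thesis by (simp add: is_ring_hom_def add)
qed

lemma is_ring_hom_of_const: "is_ring_hom of_const"
  unfolding is_ring_hom_def of_const_def
  by (auto simp flip: to_fract_add to_fract_mult to_fract_1 simp: one_pCons ac_simps)

lemma is_ring_hom_subst3: "is_ring_hom (\<lambda>P. subst3 P f g h)"
  unfolding subst3_def by (intro is_ring_hom_poly_map_poly is_ring_hom_of_const)

lemma subst3_var: "subst3 var_x f g h = f" "subst3 var_y f g h = g" "subst3 var_z f g h = h"
proof -
  note hom = is_ring_homD(1,4)
  note R = is_ring_hom_of_const
  note R1 = is_ring_hom_poly_map_poly[OF R, of f]
  note R2 = is_ring_hom_poly_map_poly[OF R1, of g]
  show "subst3 var_x f g h = f" "subst3 var_y f g h = g" "subst3 var_z f g h = h"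
    unfolding subst3_def var_x_def var_y_def var_z_def
    by (simp_all add: map_poly_pCons hom[OF R] hom[OF R1] hom[OF R2])
qed

lemmas subst3_simps = subst3_var is_ring_homD[OF is_ring_hom_subst3]


section \<open>Non-Archimedean valuations\<close>

text \<open>With \<open>s = v f\<close> and \<open>t = v g\<close>, the value predicted for a class
  of lengths \<open>p\<close> and \<open>q\<close>.\<close>

definition weight :: "real \<Rightarrow> real \<Rightarrow> nat \<Rightarrow> nat \<Rightarrow> real" where
  "weight s t p q = s ^ p * t ^ q"

text \<open>Turns the loss of a letter of one generator, without a gain in the other, into a strict
  drop in value.\<close>

lemma weight_less:
  assumes "1 < s" "1 < t" "p \<le> p'" "q \<le> q'" "p < p' \<or> q < q'"
  shows "weight s t p q < weight s t p' q'"
proof -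
  have *: "s ^ p \<le> s ^ p'" "t ^ q \<le> t ^ q'" using assms by simp_all
  have pos: "0 < s ^ p" "0 < t ^ q" using assms by simp_all
  from assms(5) show ?thesis
  proof
    assume "p < p'"
    then have "s ^ p < s ^ p'" using assms by simp
    then show ?thesis unfolding weight_def using * pos by (intro mult_less_le_imp_less) auto
  next
    assume "q < q'"
    then have "t ^ q < t ^ q'" using assms by simp
    then show ?thesis unfolding weight_def using * pos by (intro mult_le_less_imp_less) auto
  qed
qed

section \<open>The ultrametric inequality and dominant terms\<close>

context
  fixes v :: "'l::field \<Rightarrow> real"
  assumes nv: "nonarch_valuation v"
begin

lemma val_nonneg: "0 \<le> v x"
  and val_eq_0: "v x = 0 \<longleftrightarrow> x = 0"
  and val_mult: "v (x * y) = v x * v y"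
  and val_add_le: "v (x + y) \<le> max (v x) (v y)"
  using nv by (auto simp: nonarch_valuation_def)

lemma val_1: "v 1 = 1"
  using val_mult[of 1 1] val_eq_0[of 1] by simp

lemma val_minus: "v (- x) = v x"
proof -
  have "v (- 1) * v (- 1) = 1" using val_mult[of "- 1" "- 1"] val_1 by simp
  then have "v (- 1) = 1"
    using val_nonneg[of "- 1"] by (metis abs_of_nonneg mult.commute real_sqrt_abs2 real_sqrt_one)
  then show ?thesis using val_mult[of "- 1" x] by simp
qed

text \<open>Only an inequality, since \<open>2\<close> vanishes in characteristic two.\<close>

lemma val_2_le: "v 2 \<le> 1"
  using val_add_le[of 1 1] val_1 by simp

lemma val_power2: "v (x\<^sup>2) = (v x)\<^sup>2"
  by (simp add: power2_eq_square val_mult)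

lemma val_add_less: "v x < r \<Longrightarrow> v y < r \<Longrightarrow> v (x + y) < r"
  using val_add_le[of x y] by simp

text \<open>The ultrametric inequality for \<open>x = (x + y) - y\<close> excludes a drop: its
  maximum cannot be \<open>v y\<close>, which lies below \<open>v x\<close>.\<close>

lemma val_add_dominant:
  assumes "v y < v x"
  shows "v (x + y) = v x"
proof (rule antisym)
  show "v (x + y) \<le> v x" using val_add_le[of x y] assms by simp
  have "v x \<le> max (v (x + y)) (v y)" using val_add_le[of "x + y" "- y"] val_minus by simp
  then show "v x \<le> v (x + y)" using assms by (auto simp: max_def split: if_splits)
qed

lemma val_diff_dominant: "v y < v x \<Longrightarrow> v (x - y) = v x"
  using val_add_dominant[of "- y" x] val_minus by simp

end


section \<open>The valuation of \<open>Psi\<close>\<close>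

text \<open>Returns the arguments of the recursive calls to syllable form, where normal forms are
  recognisable.\<close>

lemma cls_Cons_a:
  "conj_class F2 (gen_a [^]\<^bsub>F2\<^esub> (k::int) \<otimes>\<^bsub>F2\<^esub> (gen_b [^]\<^bsub>F2\<^esub> (m::int) \<otimes>\<^bsub>F2\<^esub> syl r))
    = cls ((k, m) # r)"
  by (simp add: cls_def free_group.m_assoc)

text \<open>The power of \<open>a\<close> that the second rule moves to the end comes back to the
  front by conjugation.\<close>

lemma cls_Cons_b:
  "conj_class F2 (gen_b [^]\<^bsub>F2\<^esub> (k::int) \<otimes>\<^bsub>F2\<^esub> (syl r \<otimes>\<^bsub>F2\<^esub> gen_a [^]\<^bsub>F2\<^esub> (n::int)))
    = cls ((n, k) # r)"
  using free_group.conj_class_mult_commute[of "gen_b [^]\<^bsub>F2\<^esub> k \<otimes>\<^bsub>F2\<^esub> syl r" "gen_a [^]\<^bsub>F2\<^esub> n"]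
  by (simp add: cls_def free_group.m_assoc)

lemma normal_form_change_fst: "normal_form ((n, m) # r) \<Longrightarrow> n \<noteq> 0 \<Longrightarrow> k \<noteq> 0 \<Longrightarrow> normal_form ((k, m) # r)"
  and normal_form_change_snd: "normal_form ((n, m) # r) \<Longrightarrow> m \<noteq> 0 \<Longrightarrow> k \<noteq> 0 \<Longrightarrow> normal_form ((n, k) # r)"
  by (auto simp: normal_form_def)

section \<open>Strict domination in each kind of recursive step\<close>

context
  fixes v :: "'k::field poly fract \<Rightarrow> real" and f g h :: "'k poly fract"
  assumes nv: "nonarch_valuation v"
    and vf: "1 < v f" and vg: "1 < v g"
    and vh: "v h = v (f * g)" and vfgh: "v (f * g) = v (f * g - h)"
begin

abbreviation wt :: "nat \<Rightarrow> nat \<Rightarrow> real" where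
  "wt \<equiv> weight (v f) (v g)"

abbreviation class_weight :: "gen word set \<Rightarrow> real" where
  "class_weight W \<equiv> wt (class_len Gen_a W) (class_len Gen_b W)"

lemmas wt_less = weight_less[OF vf vg]

text \<open>The common core of all recursion rules. For \<open>W'\<close> an upper bound is assumed
  rather than equality, because \<open>W'\<close> may be the trivial class, where \<open>Psi\<close>
  is \<open>2\<close>.\<close>

lemma val_Psi_diff:
  assumes "Phi W = P - Phi W'"
    and "v (subst3 P f g h) = wt p q"
    and "v (Psi f g h W') \<le> class_weight W'"
    and "class_len Gen_a W' \<le> p" "class_len Gen_b W' \<le> q"
      "class_len Gen_a W' < p \<or> class_len Gen_b W' < q"
  shows "v (Psi f g h W) = wt p q"
proof -
  have "v (Psi f g h W') < v (subst3 P f g h)"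
    using assms(2,3) wt_less[OF assms(4-6)] by simp
  then show ?thesis
    using val_diff_dominant[OF nv] assms(1,2) unfolding Psi_def by (simp add: subst3_simps)
qed

text \<open>Both conditions on \<open>h\<close> meet here: \<open>h\<close> and
  \<open>f * g - h\<close> each have the value of \<open>f * g\<close>, so their product has value
  \<open>wt 2 2\<close> and no cancellation occurs. The term \<open>x\<close> collects the rest of a
  quartic.\<close>

lemma val_quartic:
  assumes "v x < wt 2 2"
  shows "v (h\<^sup>2 - f * g * h + x) = wt 2 2"
proof -
  have "h\<^sup>2 - f * g * h = - (h * (f * g - h))" by (simp add: power2_eq_square algebra_simps)
  then have "v (h\<^sup>2 - f * g * h) = v h * v (f * g - h)" by (simp add: val_minus[OF nv] val_mult[OF nv])
  also have "\<dots> = wt 2 2"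
    using vh vfgh by (simp add: weight_def val_mult[OF nv] power2_eq_square algebra_simps)
  finally show ?thesis using val_add_dominant[OF nv] assms by simp
qed

text \<open>The factor \<open>var_x\<close> restores the letter missing from the first class. The
  exponent \<open>n - 2 * sgn n\<close> may be zero, so the second list need not be a normal form
  and only upper bounds for its lengths are used.\<close>

lemma val_Psi_a_step:
  assumes xs: "normal_form ((n, m) # r)" and n: "2 \<le> \<bar>n\<bar>"
    and Phi: "Phi (cls ((n, m) # r)) = (var_x * Phi (cls ((n - sgn n, m) # r))
      - Phi (cls ((n - 2 * sgn n, m) # r)) :: 'k poly3)"
    and IH1: "v (Psi f g h (cls ((n - sgn n, m) # r))) = class_weight (cls ((n - sgn n, m) # r))"
    and IH2: "v (Psi f g h (cls ((n - 2 * sgn n, m) # r)))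
      \<le> class_weight (cls ((n - 2 * sgn n, m) # r))"
  shows "v (Psi f g h (cls ((n, m) # r))) = class_weight (cls ((n, m) # r))"
proof -
  have nf: "normal_form ((n - sgn n, m) # r)"
    by (rule normal_form_change_fst[OF xs]) (use n in \<open>auto simp: sgn_if\<close>)
  \<comment> \<open>As \<open>\<bar>n\<bar>\<close> is at least 2, the subtraction does not cross
    zero.\<close>
  have nat: "nat \<bar>n\<bar> = Suc (nat \<bar>n - sgn n\<bar>)" "nat \<bar>n\<bar> = nat \<bar>n - 2 * sgn n\<bar> + 2"
    using n by (auto simp: sgn_if)
  show ?thesis
    unfolding class_len_normal_form[OF xs]
  proof (rule val_Psi_diff[OF Phi _ IH2])
    show "v (subst3 (var_x * Phi (cls ((n - sgn n, m) # r))) f g h)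
      = wt (exp_sum Gen_a ((n, m) # r)) (exp_sum Gen_b ((n, m) # r))"
      using IH1 nat(1) unfolding class_len_normal_form[OF nf] weight_def Psi_def
      by (simp add: subst3_simps val_mult[OF nv])
  qed (use class_len_cls_le[of Gen_a "(n - 2 * sgn n, m) # r"]
      class_len_cls_le[of Gen_b "(n - 2 * sgn n, m) # r"] nat(2) in simp_all)
qed

text \<open>The argument for \<open>a\<close> with the exponents exchanged. Here
  \<open>n = 0\<close> is allowed, which covers pure powers of \<open>b\<close>.\<close>

lemma val_Psi_b_step:
  assumes xs: "normal_form ((n, m) # r)" and m: "2 \<le> \<bar>m\<bar>"
    and Phi: "Phi (cls ((n, m) # r)) = (var_y * Phi (cls ((n, m - sgn m) # r))
      - Phi (cls ((n, m - 2 * sgn m) # r)) :: 'k poly3)"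
    and IH1: "v (Psi f g h (cls ((n, m - sgn m) # r))) = class_weight (cls ((n, m - sgn m) # r))"
    and IH2: "v (Psi f g h (cls ((n, m - 2 * sgn m) # r)))
      \<le> class_weight (cls ((n, m - 2 * sgn m) # r))"
  shows "v (Psi f g h (cls ((n, m) # r))) = class_weight (cls ((n, m) # r))"
proof -
  have nf: "normal_form ((n, m - sgn m) # r)"
    by (rule normal_form_change_snd[OF xs]) (use m in \<open>auto simp: sgn_if\<close>)
  have nat: "nat \<bar>m\<bar> = Suc (nat \<bar>m - sgn m\<bar>)" "nat \<bar>m\<bar> = nat \<bar>m - 2 * sgn m\<bar> + 2"
    using m by (auto simp: sgn_if)
  show ?thesis
    unfolding class_len_normal_form[OF xs]
  proof (rule val_Psi_diff[OF Phi _ IH2])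
    show "v (subst3 (var_y * Phi (cls ((n, m - sgn m) # r))) f g h)
      = wt (exp_sum Gen_a ((n, m) # r)) (exp_sum Gen_b ((n, m) # r))"
      using IH1 nat(1) unfolding class_len_normal_form[OF nf] weight_def Psi_def
      by (simp add: subst3_simps val_mult[OF nv])
  qed (use class_len_cls_le[of Gen_a "(n, m - 2 * sgn m) # r"]
      class_len_cls_le[of Gen_b "(n, m - 2 * sgn m) # r"] nat(2) in simp_all)
qed

text \<open>Normality of both factors makes their lengths add up exactly to those of
  \<open>xs\<close>, while the \<open>a\<close>-length of \<open>W'\<close> is smaller by at least
  \<open>2 * \<bar>n\<bar>\<close>.\<close>

lemma val_Psi_uv_step:
  assumes us: "normal_form ((n, m) # us)" and vs: "normal_form ((n, m') # vs)"
    and n: "n \<noteq> 0" and W: "exp_sum Gen_a xs = exp_sum Gen_a ((n, m) # us) + exp_sum Gen_a ((n, m') # vs)"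
      "exp_sum Gen_b xs = exp_sum Gen_b ((n, m) # us) + exp_sum Gen_b ((n, m') # vs)"
    and W': "W' = conj_class F2 (inv\<^bsub>F2\<^esub> (syl ((n, m) # us)) \<otimes>\<^bsub>F2\<^esub> syl ((n, m') # vs))"
    and Phi: "Phi W = (Phi (cls ((n, m) # us)) * Phi (cls ((n, m') # vs)) - Phi W' :: 'k poly3)"
    and IH1: "v (Psi f g h (cls ((n, m) # us))) = class_weight (cls ((n, m) # us))"
    and IH2: "v (Psi f g h (cls ((n, m') # vs))) = class_weight (cls ((n, m') # vs))"
    and IH3: "v (Psi f g h W') \<le> class_weight W'"
  shows "v (Psi f g h W) = wt (exp_sum Gen_a xs) (exp_sum Gen_b xs)"
proof (rule val_Psi_diff[OF Phi _ IH3])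
  show "v (subst3 (Phi (cls ((n, m) # us)) * Phi (cls ((n, m') # vs))) f g h)
      = wt (exp_sum Gen_a xs) (exp_sum Gen_b xs)"
    using IH1 IH2
    unfolding class_len_normal_form[OF us] class_len_normal_form[OF vs] W weight_def Psi_def power_add
    by (simp only: subst3_simps val_mult[OF nv] ac_simps)
  have "class_len c W' \<le> exp_sum c ((0, m) # us) + exp_sum c ((0, m') # vs)" for c
    unfolding W'
    by (rule order_trans[OF class_len_le gen_count_cancel])
      (intro free_group.m_closed free_group.inv_closed syl_closed)
  from this[of Gen_a] this[of Gen_b]
  show "class_len Gen_a W' \<le> exp_sum Gen_a xs" "class_len Gen_b W' \<le> exp_sum Gen_b xs"
    "class_len Gen_a W' < exp_sum Gen_a xs \<or> class_len Gen_b W' < exp_sum Gen_b xs"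
    using n unfolding W by (simp_all, linarith)
qed

section \<open>The trivial class, and the exact value on all others\<close>

lemma val_Psi_unit: "v (Psi f g h (cls [])) \<le> class_weight (cls [])"
proof -
  have "normal_form []" by (simp add: normal_form_def)
  then show ?thesis
    using val_2_le[OF nv] class_len_normal_form[of "[]"]
    by (simp add: Psi_def Phi.simps[of "cls []"] subst3_simps weight_def)
qed

text \<open>Induction on the measure \<open>mu\<close> that makes \<open>Phi\<close> terminate.
  Special classes are evaluated directly, the others by the recursion rules.\<close>

lemma val_Psi:
  assumes "W \<in> Conj F2" "W \<noteq> cls []"
  shows "v (Psi f g h W) = class_weight W"
  using assms
proof (induction W rule: measure_induct_rule[of mu])
  case (less W)
  note W = less.prems
  have IH_eq: "v (Psi f g h W') = class_weight W'"
    if "W' \<in> Conj F2" "mu W' < mu W" "W' \<noteq> cls []" for W'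
    using less.IH that by blast
  \<comment> \<open>For subtracted terms, whose class may be trivial; the dominant products use
    \<open>IH_eq\<close>.\<close>
  have IH_le: "v (Psi f g h W') \<le> class_weight W'" if "W' \<in> Conj F2" "mu W' < mu W" for W'
    using IH_eq[OF that] val_Psi_unit by (cases "W' = cls []") auto
  note simps = Psi_def subst3_simps weight_def val_mult[OF nv] val_minus[OF nv]
  have nf: "normal_form xs \<Longrightarrow> W = cls xs \<Longrightarrow> class_len c W = exp_sum c xs" for c xs
    by (simp add: class_len_normal_form)
  note Phi = Phi.simps[of W]
  \<comment> \<open>Bounds for the terms of the two quartics outside
    \<open>h^2 - f * g * h\<close>.\<close>
  have vs: "v f ^ 2 < wt 2 2" "v g ^ 2 < wt 2 2" "v 2 < wt 2 2"
    using wt_less[of 2 2 0 2] wt_less[of 0 2 2 2] wt_less[of 0 2 0 2] val_2_le[OF nv]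
    by (simp_all add: weight_def)
  show ?case
  proof (cases "W \<in> special")
    case True
    let ?A = "{cls [(1, 0)], cls [(-1, 0)]}" and ?B = "{cls [(0, 1)], cls [(0, -1)]}"
    let ?C = "{cls [(1, 1)], cls [(-1, -1)]}" and ?D = "{cls [(-1, 1)], cls [(1, -1)]}"
    let ?E = "{cls [(1, 1), (-1, -1)], cls [(1, -1), (-1, 1)]}"
    let ?F = "{cls [(1, 1), (-1, 1)], cls [(1, -1), (-1, -1)]}"
    have cover: "W \<in> ?A \<or> W \<in> ?B \<or> W \<in> ?C \<or> W \<in> ?D \<or> W \<in> ?E \<or> W \<in> ?F"
      using True W(2) unfolding special_def insert_iff empty_iff by argo
    \<comment> \<open>Each case records the failure of the earlier tests, so the nested conditional
      in \<open>Phi\<close> reduces without a proof that the special classes are distinct.\<close>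
    consider (a) "W \<in> ?A" | (b) "W \<notin> ?A" "W \<in> ?B" | (c) "W \<notin> ?A" "W \<notin> ?B" "W \<in> ?C"
      | (d) "W \<notin> ?A" "W \<notin> ?B" "W \<notin> ?C" "W \<in> ?D"
      | (e) "W \<notin> ?A" "W \<notin> ?B" "W \<notin> ?C" "W \<notin> ?D" "W \<in> ?E"
      | (f) "W \<notin> ?A" "W \<notin> ?B" "W \<notin> ?C" "W \<notin> ?D" "W \<notin> ?E" "W \<in> ?F"
      using cover by argo
    then show ?thesis
    proof cases
      case a
      have "Phi W = (var_x :: 'k poly3)" unfolding Phi using W a by (simp only: if_True if_False not_not simp_thms)
      moreover have "class_len Gen_a W = 1" "class_len Gen_b W = 0"
        using a nf[of "[(1, 0)]"] nf[of "[(-1, 0)]"] by (auto simp: normal_form_def)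
      ultimately show ?thesis by (simp add: simps)
    next
      case b
      have "Phi W = (var_y :: 'k poly3)" unfolding Phi using W b by (simp only: if_True if_False not_not simp_thms)
      moreover have "class_len Gen_a W = 0" "class_len Gen_b W = 1"
        using b(2) nf[of "[(0, 1)]"] nf[of "[(0, -1)]"] by (auto simp: normal_form_def)
      ultimately show ?thesis by (simp add: simps)
    next
      case c
      have "Phi W = (var_z :: 'k poly3)" unfolding Phi using W c by (simp only: if_True if_False not_not simp_thms)
      moreover have "class_len Gen_a W = 1" "class_len Gen_b W = 1"
        using c(3) nf[of "[(1, 1)]"] nf[of "[(-1, -1)]"] by (auto simp: normal_form_def)
      ultimately show ?thesis using vh by (simp add: simps)
    next
      case d
      have "Phi W = (var_x * var_y - var_z :: 'k poly3)"
        unfolding Phi using W d by (simp only: if_True if_False not_not simp_thms)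
      moreover have "class_len Gen_a W = 1" "class_len Gen_b W = 1"
        using d(4) nf[of "[(-1, 1)]"] nf[of "[(1, -1)]"] by (auto simp: normal_form_def)
      ultimately show ?thesis using vfgh by (simp add: simps)
    next
      case e
      have "Phi W = (var_x\<^sup>2 + var_y\<^sup>2 + var_z\<^sup>2 - var_x * var_y * var_z - 2 :: 'k poly3)"
        unfolding Phi using W e by (simp only: if_True if_False not_not simp_thms)
      then have Psi: "Psi f g h W = h\<^sup>2 - f * g * h + (f\<^sup>2 + (g\<^sup>2 + - 2))"
        unfolding Psi_def by (simp add: subst3_simps)
      have "class_len Gen_a W = 2" "class_len Gen_b W = 2"
        using e(5) nf[of "[(1, 1), (-1, -1)]"] nf[of "[(1, -1), (-1, 1)]"] by (auto simp: normal_form_def)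
      moreover have "v (f\<^sup>2 + (g\<^sup>2 + - 2)) < wt 2 2"
        using vs by (intro val_add_less[OF nv]) (simp_all only: val_power2[OF nv] val_minus[OF nv])
      ultimately show ?thesis unfolding Psi using val_quartic by simp
    next
      case f
      have "Phi W = (- var_x\<^sup>2 - var_z\<^sup>2 + var_x * var_y * var_z + 2 :: 'k poly3)"
        unfolding Phi using W f by (simp only: if_True if_False not_not simp_thms)
      \<comment> \<open>Up to sign this has the same dominant part as the other quartic.\<close>
      then have Psi: "Psi f g h W = - (h\<^sup>2 - f * g * h + (f\<^sup>2 + - 2))"
        unfolding Psi_def by (simp add: subst3_simps)
      have "class_len Gen_a W = 2" "class_len Gen_b W = 2"
        using f(6) nf[of "[(1, 1), (-1, 1)]"] nf[of "[(1, -1), (-1, -1)]"] by (auto simp: normal_form_def)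
      moreover have "v (f\<^sup>2 + - 2) < wt 2 2"
        using vs by (intro val_add_less[OF nv]) (simp_all only: val_power2[OF nv] val_minus[OF nv])
      ultimately show ?thesis unfolding Psi val_minus[OF nv] using val_quartic by simp
    qed
  next
    case False
    then have ns: "W \<noteq> cls []"
      "W \<notin> {cls [(1, 0)], cls [(-1, 0)]}" "W \<notin> {cls [(0, 1)], cls [(0, -1)]}"
      "W \<notin> {cls [(1, 1)], cls [(-1, -1)]}" "W \<notin> {cls [(-1, 1)], cls [(1, -1)]}"
      "W \<notin> {cls [(1, 1), (-1, -1)], cls [(1, -1), (-1, 1)]}"
      "W \<notin> {cls [(1, 1), (-1, 1)], cls [(1, -1), (-1, -1)]}"
      unfolding special_def by blast+
    define xs where "xs = canonical W"
    obtain n m r where xs_eq: "xs = (n, m) # r"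
      using canonical_Cons[OF W] unfolding xs_def by metis
    have hd_xs: "fst (hd xs) = n" "snd (hd xs) = m" "tl xs = r" by (simp_all add: xs_eq)
    have xs_nf: "normal_form ((n, m) # r)"
      using normal_form_canonical[OF W(1)] xs_def xs_eq by simp
    have W_cls: "W = cls ((n, m) # r)" using cls_canonical[OF W(1)] xs_def xs_eq by simp
    \<comment> \<open>A nonempty normal form has positive \<open>wlen\<close>, whereas both lengths
      of the trivial class vanish. This gives access to \<open>IH_eq\<close>.\<close>
    have not_unit: "normal_form ys \<Longrightarrow> ys \<noteq> [] \<Longrightarrow> cls ys \<noteq> cls []" for ys
    proof
      assume ys: "normal_form ys" "ys \<noteq> []" "cls ys = cls []"
      then have "exp_sum c ys = 0" for c
        using class_len_normal_form[OF ys(1), of c] class_len_cls_le[of c "[]"] by simp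
      then have "wlen ys = 0" by (simp add: wlen_exp_sum)
      then show False using length_le_wlen[OF ys(1)] ys(2) by simp
    qed
    note Phi = Phi[unfolded Let_def, folded xs_def, unfolded hd_xs]
    note red = W ns if_True if_False not_not simp_thms
    consider (i) "2 \<le> \<bar>n\<bar>"
      | (ii) "\<not> 2 \<le> \<bar>n\<bar>" "2 \<le> \<bar>m\<bar> \<and> (\<bar>n\<bar> = 1 \<or> xs = [(0, m)])"
      | (iii) "\<not> 2 \<le> \<bar>n\<bar>" "\<not> (2 \<le> \<bar>m\<bar> \<and> (\<bar>n\<bar> = 1 \<or> xs = [(0, m)]))"
      by blast
    then show ?thesis
    proof cases
      case i
      have mu: "mu (cls ((k, m) # r)) < mu W" if "\<bar>k\<bar> < \<bar>n\<bar>" for k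
        using mu_less_a[OF W xs_def, of k] that unfolding hd_xs cls_Cons_a by blast
      have nf1: "normal_form ((n - sgn n, m) # r)"
        by (rule normal_form_change_fst[OF xs_nf]) (use i in \<open>auto simp: sgn_if\<close>)
      have "Phi W = (var_x * Phi (cls ((n - sgn n, m) # r)) - Phi (cls ((n - 2 * sgn n, m) # r)) :: 'k poly3)"
        unfolding Phi cls_Cons_a using i by (simp only: red)
      then show ?thesis
        unfolding W_cls
        by (intro val_Psi_a_step[OF xs_nf i] IH_eq IH_le cls_Conj mu abs_sgn_less i not_unit nf1)
          simp_all
    next
      case ii
      have mu: "mu (cls ((n, k) # r)) < mu W" if "\<bar>k\<bar> < \<bar>m\<bar>" for k
        using mu_less_b[OF W xs_def, of k] that unfolding hd_xs cls_Cons_b by blast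
      have m: "2 \<le> \<bar>m\<bar>" using ii by blast
      have nf1: "normal_form ((n, m - sgn m) # r)"
        by (rule normal_form_change_snd[OF xs_nf]) (use m in \<open>auto simp: sgn_if\<close>)
      have "Phi W = (var_y * Phi (cls ((n, m - sgn m) # r)) - Phi (cls ((n, m - 2 * sgn m) # r)) :: 'k poly3)"
        unfolding Phi cls_Cons_b using ii by (simp only: red)
      then show ?thesis
        unfolding W_cls
        by (intro val_Psi_b_step[OF xs_nf m] IH_eq IH_le cls_Conj mu abs_sgn_less m not_unit nf1)
          simp_all
    next
      case iii
      note c = canonical_nonspecial[OF W(1) False xs_def, unfolded hd_xs, OF iii]
      define i where "i = (LEAST i. \<exists>j. equal_pair xs i j)"
      define j where "j = (LEAST j. equal_pair xs i j)"
      define us where "us = take (j - i) (drop i xs)"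
      define vs where "vs = drop j xs @ take i xs"
      note mu = mu_less_uv[OF W(1) False xs_def, unfolded hd_xs, OF iii i_def j_def,
          OF us_def[THEN arg_cong[where f = syl]] vs_def[THEN arg_cong[where f = syl]]]
      have Phi: "Phi W = (Phi (cls us) * Phi (cls vs)
          - Phi (conj_class F2 (inv\<^bsub>F2\<^esub> (syl us) \<otimes>\<^bsub>F2\<^esub> syl vs)) :: 'k poly3)"
        unfolding Phi us_def vs_def i_def j_def using iii by (simp only: red flip: cls_def)
      have ij: "i < j" "j < length xs" "fst (xs ! i) = fst (xs ! j)"
        using least_equal_pair[OF conjunct2[OF c] i_def j_def] by (auto simp: equal_pair_def)
      \<comment> \<open>By the choice of \<open>i\<close> and \<open>j\<close>, the lists
        \<open>us\<close> and \<open>vs\<close> start with the same exponent of \<open>a\<close>, as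
        the cancellation requires.\<close>
      obtain p m1 m2 where p: "xs ! i = (p, m1)" "xs ! j = (p, m2)"
        using ij(3) by (metis prod.collapse)
      have "us = (p, m1) # take (j - Suc i) (drop (Suc i) xs)"
      proof -
        have "drop i xs = xs ! i # drop (Suc i) xs" "j - i = Suc (j - Suc i)"
          using ij by (simp_all add: Cons_nth_drop_Suc)
        then show ?thesis unfolding us_def p(1) by (metis take_Suc_Cons)
      qed
      then obtain us' where us': "us = (p, m1) # us'" by blast
      have "vs = (p, m2) # drop (Suc j) xs @ take i xs"
        using Cons_nth_drop_Suc[OF ij(2)] unfolding vs_def p(2) by (metis append_Cons)
      then obtain vs' where vs': "vs = (p, m2) # vs'" by blast
      have "xs = take i xs @ us @ drop j xs"
      proof -
        have "drop j xs = drop (j - i) (drop i xs)" using ij by simp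
        then show ?thesis unfolding us_def by (metis append_take_drop_id)
      qed
      \<comment> \<open>Exponent sums ignore order, so the cyclic rearrangement in \<open>vs\<close>
        is harmless.\<close>
      then have sum: "exp_sum c xs = exp_sum c us + exp_sum c vs" for c
        unfolding vs_def by (metis add.assoc add.commute exp_sum_simps(3))
      \<comment> \<open>All exponents are \<open>1\<close> or \<open>-1\<close> in this case, so
        nonempty lists of these syllables are again normal forms.\<close>
      have "all_nz xs" using conjunct1[OF c] by (auto simp: all_nz_def)
      then have "all_nz us" "all_nz vs"
        unfolding us_def vs_def all_nz_def
        by (auto dest: in_set_takeD in_set_dropD)
      then have nf_uv: "normal_form us" "normal_form vs" "p \<noteq> 0"
        unfolding us' vs' by (auto simp: normal_form_def all_nz_def)
      have W_len: "class_len c W = exp_sum c xs" for c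
        by (simp add: class_len_def xs_def)
      have ne: "us \<noteq> []" "vs \<noteq> []" by (simp_all add: us' vs')
      have closed: "conj_class F2 (inv\<^bsub>F2\<^esub> (syl us) \<otimes>\<^bsub>F2\<^esub> syl vs) \<in> Conj F2"
        unfolding Conj_def by (intro imageI free_group.m_closed free_group.inv_closed syl_closed)
      have IHs: "v (Psi f g h (cls us)) = class_weight (cls us)"
        "v (Psi f g h (cls vs)) = class_weight (cls vs)"
        using IH_eq[OF cls_Conj] mu(1,2) not_unit nf_uv ne by (simp_all add: cls_def)
      show ?thesis
        unfolding W_len
        by (rule val_Psi_uv_step[OF nf_uv(1,2)[unfolded us' vs'] nf_uv(3)
            sum[unfolded us' vs'] sum[unfolded us' vs'] refl Phi[unfolded us' vs']
            IHs[unfolded us' vs'] IH_le[OF closed mu(3), unfolded us' vs']])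
    qed
  qed
qed

text \<open>The canonical list of a nontrivial class is nonempty, so at least one of the two lengths
  is positive.\<close>

lemma class_weight_gt_1:
  assumes "W \<in> Conj F2" "W \<noteq> cls []"
  shows "1 < class_weight W"
proof -
  have "wlen (canonical W) \<noteq> 0"
    using length_le_wlen[OF normal_form_canonical[OF assms(1)]] canonical_Cons[OF assms]
    by (metis le_zero_eq length_0_conv list.distinct(1))
  then have "0 < class_len Gen_a W \<or> 0 < class_len Gen_b W"
    by (simp add: wlen_exp_sum class_len_def)
  then show ?thesis
    using wt_less[of 0 "class_len Gen_a W" 0 "class_len Gen_b W"] by (simp add: weight_def)
qed

end

theorem theorem4p15:
  fixes v :: "'k::field poly fract \<Rightarrow> real"
    and f g h :: "'k poly fract"
    and W :: "gen word set"
  assumes "nonarch_valuation v"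
    and "trivial_on v (range of_const)"
    and "v f > 1"
    and "v g > 1"
    and "v h = v (f * g)"
    and "v (f * g) = v (f * g - h)"
    and "W \<in> Conj F2"
    and "W \<noteq> conj_class F2 \<one>\<^bsub>F2\<^esub>"
  shows "v (Psi f g h W) = v f ^ l_a W * v g ^ l_b W
    \<and> v f ^ l_a W * v g ^ l_b W > 1
    \<and> Psi f g h W \<notin> range of_const"
proof -
  have W: "W \<in> Conj F2" "W \<noteq> cls []" using assms(7,8) by (simp_all add: cls_def)
  note val = val_Psi[OF assms(1,3-6) W, unfolded weight_def]
  note gt = class_weight_gt_1[OF assms(1,3-6) W, unfolded weight_def]
  \<comment> \<open>Constants have value 0 or 1, so an element of value above 1 is not
    constant.\<close>
  have "v x \<le> 1" if "x \<in> range of_const" for x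
    using assms(2) that val_eq_0[OF assms(1), of x] by (cases "x = 0") (auto simp: trivial_on_def)
  then show ?thesis
    using val gt unfolding l_a_class_len l_b_class_len by fastforce
qed

end
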